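(* Let $\sigma=0$. Then the value function $V$ of the shallow lake problem is a continuous constrained viscosity solution on $[0,\infty)$ of $$\rho V-(r(x)-bx)V_x+\ln(-V_x)+cx^2+1=0 .$$ Moreover, $V$ satisfies this equation at $x=0$ in the classical sense, i.e. $V$ is (one-sidedly) differentiable at $0$ and $\ln(-V'(0))+\rho V(0)+1=0$.
   Context: Shallow lake problem. Fix parameters $b,c,\rho>0$ and noise intensity $\sigma$ (the deterministic problem is $\sigma=0$). Fix a filtered probability space $(\Omega,\mathcal F,\{\mathcal F_t\}_{t\ge0},\mathbb P)$ satisfying the usual conditions, carrying a Brownian motion $W$. For $x\ge 0$ the state equation is $$dx(t)=\big(u(t)-bx(t)+r(x(t))\big)dt+\sigma x(t)\,dW_t,\qquad x(0)=x .$$ The recycling rate $r$ is a sigmoid function satisfying: (1) $r\in C^1([0,\infty))$ is non-decreasing; (2) $r(0)=0$ and $r(x)\le (b+\rho)x$ for $x$ close to $0$; (3) $a:=\lim_{x\to\infty}r(x)<\infty$; (4) $\lim_{x\to\infty}(a-r(x))x$ exists and is a finite real number; (5) $\lim_{x\to\infty}r'(x)=0$. An admissible control $u\in\mathfrak U_x$ is an $\mathcal F_t$-adapted, $\mathbb P$-a.s. locally integrable process with values in $(0,\infty)$, with $\mathbb E[\int_0^\infty e^{-\rho t}\ln u(t)\,dt]<\infty$, such that the state equation has a unique strong solution $x(\cdot)$. The benefit and value function are $$J(x;u)=\mathbb E_x\Big[\int_0^\infty e^{-\rho t}\big(\ln u(t)-cx^2(t)\big)dt\Big],\qquad V(x)=\sup_{u\in\mathfrak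 U_x}J(x;u),\quad x\ge0 .$$ Viscosity solutions. Let $H(x,p)=\sup_{u>0}\{(u-bx+r(x))p+\ln u-cx^2\}$, which equals $(r(x)-bx)p-\ln(-p)-1-cx^2$ for $p<0$ and $+\infty$ for $p\ge0$; the equation is $\rho V-H(x,V_x)=0$. A continuous function $w$ is a viscosity subsolution in $[0,\infty)$ if $\rho w(x)-H(x,\phi'(x))\le0$ whenever $\phi$ is smooth and $w-\phi$ has a local maximum relative to $[0,\infty)$ at $x\in[0,\infty)$; it is a viscosity supersolution in $(0,\infty)$ if $\rho w(x)-H(x,\phi'(x))\ge0$ whenever $\phi$ is smooth and $w-\phi$ has a local minimum at $x\in(0,\infty)$. It is a constrained viscosity solution on $[0,\infty)$ if it is a subsolution in $[0,\infty)$ and a supersolution in $(0,\infty)$. *)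

theory Defs
  imports "HOL-Probability.Probability"
begin

subsection \<open>Filtered probability spaces and Brownian motion\<close>

text \<open>
  Processes are functions of a real time parameter; only times \<open>t \<ge> 0\<close> are meaningful, and no
  condition is imposed at negative times.
\<close>

locale usual_filtration = prob_space M for M :: "'a measure" +
  fixes F :: "real \<Rightarrow> 'a measure"
  assumes subalgebra_F: "t \<ge> 0 \<Longrightarrow> subalgebra M (F t)"
    and mono_F: "0 \<le> s \<Longrightarrow> s \<le> t \<Longrightarrow> sets (F s) \<subseteq> sets (F t)"
    and right_continuous_F: "t \<ge> 0 \<Longrightarrow> sets (F t) = (\<Inter>s\<in>{t<..}. sets (F s))"
    and complete_F: "N \<in> null_sets M \<Longrightarrow> A \<subseteq> N \<Longrightarrow> A \<in> sets (F 0)"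

definition adapted :: "(real \<Rightarrow> 'a measure) \<Rightarrow> (real \<Rightarrow> 'a \<Rightarrow> real) \<Rightarrow> bool" where
  "adapted F X \<longleftrightarrow> (\<forall>t\<ge>0. X t \<in> borel_measurable (F t))"

locale brownian_motion = usual_filtration M F for M :: "'a measure" and F +
  fixes W :: "real \<Rightarrow> 'a \<Rightarrow> real"
  assumes adapted_W: "adapted F W"
    and start_W: "AE \<omega> in M. W 0 \<omega> = 0"
    and continuous_W: "AE \<omega> in M. continuous_on {0..} (\<lambda>t. W t \<omega>)"
    and normal_increments: "0 \<le> s \<Longrightarrow> s < t \<Longrightarrow>
          distributed M lborel (\<lambda>\<omega>. W t \<omega> - W s \<omega>) (normal_density 0 (sqrt (t - s)))"
    and indep_increments: "0 \<le> s \<Longrightarrow> s < t \<Longrightarrow>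
          indep_set (sets (F s)) (sets (vimage_algebra (space M) (\<lambda>\<omega>. W t \<omega> - W s \<omega>) borel))"


subsection \<open>Extended-real-valued integrals\<close>

text \<open>
  The integral of the positive part minus the integral of the negative part
  (\<open>e2ennreal\<close> truncates negative numbers to 0). As \<open>\<infinity> - \<infinity> = \<infinity>\<close> in \<open>ereal\<close>, a value
  \<open>< \<infinity>\<close> says precisely that the positive part has a finite integral, so that the integral
  is well defined in \<open>[-\<infinity>, \<infinity>)\<close>.
\<close>

definition ext_integral :: "'b measure \<Rightarrow> ('b \<Rightarrow> ereal) \<Rightarrow> ereal" where
  "ext_integral N f =
     enn2ereal (\<integral>\<^sup>+ y. e2ennreal (f y) \<partial>N) - enn2ereal (\<integral>\<^sup>+ y. e2ennreal (- f y) \<partial>N)"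

lemma ext_integral_eq_integral:
  fixes f :: "'b \<Rightarrow> real"
  assumes "integrable N f"
  shows "ext_integral N (\<lambda>y. ereal (f y)) = ereal (integral\<^sup>L N f)"
proof -
  have fin: "(\<integral>\<^sup>+ y. ennreal (f y) \<partial>N) \<noteq> \<infinity>" "(\<integral>\<^sup>+ y. ennreal (- f y) \<partial>N) \<noteq> \<infinity>"
    using assms by (auto simp: real_integrable_def)
  obtain p q where "p \<ge> 0" "q \<ge> 0" "(\<integral>\<^sup>+ y. ennreal (f y) \<partial>N) = ennreal p"
    "(\<integral>\<^sup>+ y. ennreal (- f y) \<partial>N) = ennreal q"
    using fin by (metis ennreal_cases infinity_ennreal_def)
  then show ?thesis
    by (simp add: ext_integral_def real_lebesgue_integral_def[OF assms] enn2ereal_ennreal)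
qed

definition half_line :: "real measure" where
  "half_line = restrict_space lborel {0..}"


subsection \<open>The recycling rate\<close>

definition recycling_rate :: "real \<Rightarrow> real \<Rightarrow> (real \<Rightarrow> real) \<Rightarrow> bool" where
  "recycling_rate b \<rho> r \<longleftrightarrow>
     mono_on {0..} r \<and>
     r 0 = 0 \<and> (\<forall>\<^sub>F x in at_right 0. r x \<le> (b + \<rho>) * x) \<and>
     (\<exists>a. (r \<longlongrightarrow> a) at_top \<and> (\<exists>l. ((\<lambda>x. (a - r x) * x) \<longlongrightarrow> l) at_top)) \<and>
     (\<exists>r'. (\<forall>x\<ge>0. (r has_real_derivative r' x) (at x within {0..})) \<and>
           continuous_on {0..} r' \<and> (r' \<longlongrightarrow> 0) at_top)"


subsection \<open>The noiseless controlled state equation\<close>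

text \<open>
  For \<open>\<sigma> = 0\<close> the stochastic integral vanishes and the state equation
  \<open>dx = (u - b x + r(x)) dt\<close> is, in integrated form, a pathwise integral equation.
  Since \<open>r\<close> is a function on \<open>[0,\<infinity>)\<close>, states are non-negative.
\<close>

definition strong_solution ::
  "'a measure \<Rightarrow> (real \<Rightarrow> 'a measure) \<Rightarrow> real \<Rightarrow> (real \<Rightarrow> real) \<Rightarrow> real \<Rightarrow>
   (real \<Rightarrow> 'a \<Rightarrow> real) \<Rightarrow> (real \<Rightarrow> 'a \<Rightarrow> real) \<Rightarrow> bool" where
  "strong_solution M F b r x u X \<longleftrightarrow>
     adapted F X \<and>
     (AE \<omega> in M. continuous_on {0..} (\<lambda>t. X t \<omega>) \<and>
        (\<forall>t\<ge>0. X t \<omega> \<ge> 0 \<and>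
           X t \<omega> = x + (LINT s:{0..t}|lborel. u s \<omega> - b * X s \<omega> + r (X s \<omega>))))"

definition indistinguishable ::
  "'a measure \<Rightarrow> (real \<Rightarrow> 'a \<Rightarrow> real) \<Rightarrow> (real \<Rightarrow> 'a \<Rightarrow> real) \<Rightarrow> bool" where
  "indistinguishable M X Y \<longleftrightarrow> (AE \<omega> in M. \<forall>t\<ge>0. X t \<omega> = Y t \<omega>)"

text \<open>
  Joint measurability of a control makes its pathwise time integrals random variables, so that
  their expectations are meaningful.
\<close>

definition admissible ::
  "'a measure \<Rightarrow> (real \<Rightarrow> 'a measure) \<Rightarrow> real \<Rightarrow> real \<Rightarrow> (real \<Rightarrow> real) \<Rightarrow> real \<Rightarrow>
   (real \<Rightarrow> 'a \<Rightarrow> real) set" where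
  "admissible M F b \<rho> r x =
     {u. adapted F u \<and>
         (\<lambda>(t, \<omega>). u t \<omega>) \<in> borel_measurable (half_line \<Otimes>\<^sub>M M) \<and>
         (\<forall>t\<ge>0. \<forall>\<omega>\<in>space M. u t \<omega> > 0) \<and>
         (AE \<omega> in M. \<forall>T\<ge>0. set_integrable lborel {0..T} (\<lambda>t. u t \<omega>)) \<and>
         ext_integral M (\<lambda>\<omega>. ext_integral half_line (\<lambda>t. ereal (exp (- \<rho> * t) * ln (u t \<omega>)))) < \<infinity> \<and>
         (\<exists>X. strong_solution M F b r x u X) \<and>
         (\<forall>X Y. strong_solution M F b r x u X \<longrightarrow> strong_solution M F b r x u Y \<longrightarrow>
                indistinguishable M X Y)}"

text \<open>
  For admissible controls the state is unique up to indistinguishability, which does not affect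
  the benefit.
\<close>

definition state_process ::
  "'a measure \<Rightarrow> (real \<Rightarrow> 'a measure) \<Rightarrow> real \<Rightarrow> (real \<Rightarrow> real) \<Rightarrow> real \<Rightarrow>
   (real \<Rightarrow> 'a \<Rightarrow> real) \<Rightarrow> real \<Rightarrow> 'a \<Rightarrow> real" where
  "state_process M F b r x u = (SOME X. strong_solution M F b r x u X)"

definition benefit ::
  "'a measure \<Rightarrow> (real \<Rightarrow> 'a measure) \<Rightarrow> real \<Rightarrow> real \<Rightarrow> real \<Rightarrow> (real \<Rightarrow> real) \<Rightarrow> real \<Rightarrow>
   (real \<Rightarrow> 'a \<Rightarrow> real) \<Rightarrow> ereal" where
  "benefit M F b c \<rho> r x u =
     ext_integral M (\<lambda>\<omega>. ext_integral half_line
       (\<lambda>t. ereal (exp (- \<rho> * t) * (ln (u t \<omega>) - c * (state_process M F b r x u t \<omega>)\<^sup>2))))"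

definition value_function ::
  "'a measure \<Rightarrow> (real \<Rightarrow> 'a measure) \<Rightarrow> real \<Rightarrow> real \<Rightarrow> real \<Rightarrow> (real \<Rightarrow> real) \<Rightarrow> real \<Rightarrow> ereal"
  where
  "value_function M F b c \<rho> r x = (SUP u\<in>admissible M F b \<rho> r x. benefit M F b c \<rho> r x u)"

locale shallow_lake = brownian_motion M F W
  for M :: "'a measure" and F and W +
  fixes b c \<rho> :: real and r :: "real \<Rightarrow> real"
  assumes pos_b: "b > 0" and pos_c: "c > 0" and pos_\<rho>: "\<rho> > 0"
    and recycling_rate: "recycling_rate b \<rho> r"


subsection \<open>Constrained viscosity solutions\<close>

definition hamiltonian :: "real \<Rightarrow> real \<Rightarrow> (real \<Rightarrow> real) \<Rightarrow> real \<Rightarrow> real \<Rightarrow> ereal" where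
  "hamiltonian b c r x p = (SUP u\<in>{0<..}. ereal ((u - b * x + r x) * p + ln u - c * x\<^sup>2))"

lemma hamiltonian_neg:
  assumes "p < 0"
  shows "hamiltonian b c r x p = ereal ((r x - b * x) * p - ln (- p) - 1 - c * x\<^sup>2)"
  unfolding hamiltonian_def
proof (rule antisym)
  show "(SUP u\<in>{0<..}. ereal ((u - b * x + r x) * p + ln u - c * x\<^sup>2))
        \<le> ereal ((r x - b * x) * p - ln (- p) - 1 - c * x\<^sup>2)"
  proof (rule SUP_least)
    fix u :: real assume "u \<in> {0<..}"
    then have u: "u > 0" by simp
    then have "ln (u * - p) \<le> u * - p - 1"
      using assms by (intro ln_le_minus_one mult_pos_pos) auto
    moreover have "ln (u * - p) = ln u + ln (- p)"
      using assms u by (intro ln_mult_pos) auto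
    ultimately show "ereal ((u - b * x + r x) * p + ln u - c * x\<^sup>2)
        \<le> ereal ((r x - b * x) * p - ln (- p) - 1 - c * x\<^sup>2)"
      by (simp add: algebra_simps)
  qed
  have "ln (- 1 / p) = - ln (- p)"
    using assms ln_inverse[of "- p"] by (simp add: field_simps inverse_eq_divide)
  moreover have "(- 1 / p - b * x + r x) * p = - 1 + (r x - b * x) * p"
    using assms by (simp add: field_simps)
  ultimately have "ereal ((r x - b * x) * p - ln (- p) - 1 - c * x\<^sup>2)
      = ereal ((- 1 / p - b * x + r x) * p + ln (- 1 / p) - c * x\<^sup>2)"
    by simp
  also have "\<dots> \<le> (SUP u\<in>{0<..}. ereal ((u - b * x + r x) * p + ln u - c * x\<^sup>2))"
    using assms by (intro SUP_upper) (simp add: divide_neg_neg)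
  finally show "ereal ((r x - b * x) * p - ln (- p) - 1 - c * x\<^sup>2)
      \<le> (SUP u\<in>{0<..}. ereal ((u - b * x + r x) * p + ln u - c * x\<^sup>2))" .
qed

lemma hamiltonian_nonneg:
  assumes "p \<ge> 0"
  shows "hamiltonian b c r x p = \<infinity>"
proof (rule ereal_top)
  fix B :: real
  define v where "v = B - (r x - b * x) * p + c * x\<^sup>2"
  have "0 \<le> exp v * p" using assms by simp
  then have "ereal B \<le> ereal ((exp v - b * x + r x) * p + ln (exp v) - c * x\<^sup>2)"
    by (simp add: v_def algebra_simps)
  also have "\<dots> \<le> hamiltonian b c r x p"
    unfolding hamiltonian_def by (intro SUP_upper) simp
  finally show "ereal B \<le> hamiltonian b c r x p" .
qed

definition smooth :: "(real \<Rightarrow> real) \<Rightarrow> bool" where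
  "smooth \<phi> \<longleftrightarrow> (\<forall>n x. ((deriv ^^ n) \<phi>) differentiable (at x))"

definition local_max_rel :: "(real \<Rightarrow> real) \<Rightarrow> real set \<Rightarrow> real \<Rightarrow> bool" where
  "local_max_rel g S x \<longleftrightarrow> (\<forall>\<^sub>F y in at x within S. g y \<le> g x)"

definition local_min_rel :: "(real \<Rightarrow> real) \<Rightarrow> real set \<Rightarrow> real \<Rightarrow> bool" where
  "local_min_rel g S x \<longleftrightarrow> (\<forall>\<^sub>F y in at x within S. g x \<le> g y)"

definition viscosity_subsolution ::
  "real \<Rightarrow> (real \<Rightarrow> real \<Rightarrow> ereal) \<Rightarrow> real set \<Rightarrow> (real \<Rightarrow> real) \<Rightarrow> bool" where
  "viscosity_subsolution \<rho> H S w \<longleftrightarrow>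
     (\<forall>\<phi>. \<forall>x\<in>S. smooth \<phi> \<longrightarrow> local_max_rel (\<lambda>y. w y - \<phi> y) S x \<longrightarrow>
        ereal (\<rho> * w x) - H x (deriv \<phi> x) \<le> 0)"

definition viscosity_supersolution ::
  "real \<Rightarrow> (real \<Rightarrow> real \<Rightarrow> ereal) \<Rightarrow> real set \<Rightarrow> (real \<Rightarrow> real) \<Rightarrow> bool" where
  "viscosity_supersolution \<rho> H S w \<longleftrightarrow>
     (\<forall>\<phi>. \<forall>x\<in>S. smooth \<phi> \<longrightarrow> local_min_rel (\<lambda>y. w y - \<phi> y) S x \<longrightarrow>
        ereal (\<rho> * w x) - H x (deriv \<phi> x) \<ge> 0)"

definition constrained_viscosity_solution ::
  "real \<Rightarrow> (real \<Rightarrow> real \<Rightarrow> ereal) \<Rightarrow> (real \<Rightarrow> real) \<Rightarrow> bool" where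
  "constrained_viscosity_solution \<rho> H w \<longleftrightarrow>
     continuous_on {0..} w \<and>
     viscosity_subsolution \<rho> H {0..} w \<and>
     viscosity_supersolution \<rho> H {0<..} w"

end

theory Submission
  imports Defs "HOL-Real_Asymp.Real_Asymp"
begin

text \<open>
  Without noise the state equation holds path by path, so randomness gives the controller no
  advantage. Almost every path of an admissible control is a pair of real functions, a control
  \<open>u\<close> and a state \<open>X\<close>, and its discounted benefit is at most the supremum \<open>V x\<close> over all such
  pairs; averaging over the paths keeps this bound. Conversely a deterministic control is
  adapted, and its state is unique because \<open>r\<close> is Lipschitz. Hence the value function is \<open>V\<close>
  (\<open>value_function_eq_V\<close>), and what remains is deterministic.

  States are chosen before controls. If \<open>X\<close> is a non-negative curve with
  \<open>u = X' + b X - r(X) > 0\<close>, then \<open>u\<close> steers the lake along \<open>X\<close>. All comparisons below write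
  down a curve in this way (\<open>solves_perturb\<close>, \<open>solves_glue\<close>), so no differential equation has to
  be solved.

  \<^item> \<open>V\<close> is finite since a large control is punished by the state that it produces:
    \<open>ln u - k x\<^sup>2\<close> is at most \<open>u/(1+x)\<^sup>2 + 1/k\<close>, and \<open>\<integral> u/(1+X)\<^sup>2\<close> over \<open>[0,T]\<close> is at most
    \<open>1 + b T\<close> because \<open>1/(1+X)\<close> lies in \<open>[0,1]\<close> and decreases at least at the rate
    \<open>u/(1+X)\<^sup>2 - b\<close> (\<open>weighted_control_integral_le\<close>). The same estimate bounds the discounted
    integral of \<open>X\<^sup>2\<close> along good paths.

  \<^item> \<open>V\<close> is non-increasing, because a larger state can be reached in a short time at a small cost
    (\<open>V_antimono\<close>). It is continuous, because from a slightly larger initial state one can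
    follow a given path at a distance that stays small for a long time and bounded forever,
    using at least the same control (\<open>V_tracking\<close>).

  \<^item> Dynamic programming gives two estimates over short times. Moving with constant speed bounds
    \<open>V\<close> from below (\<open>V_ge_after_constant_speed\<close>). For the bound from above,
    \<open>ln u \<le> ln q - 1 + u/q\<close> turns the unbounded control into the increment of the state
    (\<open>payoff_le_while_near_start\<close>); with \<open>q = -1/p\<close> this is exactly the Hamiltonian at slope \<open>p\<close>.

  The lower estimate is the supersolution property. The upper estimate, used up to the exit time
  from a small neighbourhood, is the subsolution property on all of \<open>[0,\<infinity>)\<close>. At \<open>0\<close> both
  estimates apply. With \<open>q = exp (1 + \<rho> V 0)\<close> as the speed in the first one and as the point of
  tangency in the second one they meet in \<open>V h = V 0 - h/q + o(h)\<close>, so \<open>V\<close> has the one-sided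
  derivative \<open>- 1/q\<close>, which solves the equation.
\<close>


section \<open>Integrals and continuity on the half-line\<close>

lemma set_integrable_mult_continuous:
  fixes f g :: "real \<Rightarrow> real"
  assumes f: "set_integrable lborel {s..t} f" and g: "continuous_on {s..t} g"
  shows "set_integrable lborel {s..t} (\<lambda>x. f x * g x)"
proof -
  obtain B where "\<forall>y\<in>g ` {s..t}. norm y \<le> B"
    using compact_imp_bounded[OF compact_continuous_image[OF g compact_Icc]]
    unfolding bounded_iff by blast
  then have B: "\<bar>g x\<bar> \<le> B" if "x \<in> {s..t}" for x
    using that by auto
  have "(\<lambda>x. (indicat_real {s..t} x *\<^sub>R f x) * (indicat_real {s..t} x *\<^sub>R g x))
      \<in> borel_measurable lborel"
    using f borel_measurable_continuous_on_indicator[OF _ g] unfolding set_integrable_def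
    by (intro borel_measurable_times) (auto intro: borel_measurable_integrable)
  moreover have "(\<lambda>x. (indicat_real {s..t} x *\<^sub>R f x) * (indicat_real {s..t} x *\<^sub>R g x))
      = (\<lambda>x. indicat_real {s..t} x *\<^sub>R (f x * g x))"
    by (auto simp: indicator_def)
  ultimately have meas: "set_borel_measurable lborel {s..t} (\<lambda>x. f x * g x)"
    by (simp add: set_borel_measurable_def)
  have "norm (f x * g x) \<le> norm (B * f x)" if "x \<in> {s..t}" for x
    using B[OF that] by (simp add: abs_mult mult.commute[of "\<bar>f x\<bar>"] mult_mono)
  then show ?thesis
    using meas f by (intro set_integrable_bound[OF _ meas, of "\<lambda>x. B * f x"]) auto
qed

lemma set_integrable_Icc_sub:
  fixes f :: "real \<Rightarrow> real"
  assumes "set_integrable lborel {a..b} f" "a \<le> s" "t \<le> b"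
  shows "set_integrable lborel {s..t} f"
  using assms by (auto intro: set_integrable_subset)

lemma set_integral_Icc_combine:
  fixes f :: "real \<Rightarrow> real"
  assumes f: "set_integrable lborel {a..c} f" and "a \<le> b" "b \<le> c"
  shows "(LINT x:{a..c}|lborel. f x) = (LINT x:{a..b}|lborel. f x) + (LINT x:{b..c}|lborel. f x)"
proof -
  have "set_integrable lborel {a..b} f" "set_integrable lborel {b..c} f"
    using assms by (auto intro: set_integrable_subset)
  then show ?thesis
    using assms by (simp add: set_borel_integral_eq_integral Henstock_Kurzweil_Integration.integral_combine)
qed

lemma set_integral_Icc_const:
  "s \<le> t \<Longrightarrow> (LINT x:{s..t}|lborel. (k::real)) = (t - s) * k"
  by (simp add: set_integral_const measure_lborel_Icc)

lemma set_integrable_Icc_const: "set_integrable lborel {s..t::real} (\<lambda>x. k::real)"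
  by (intro borel_integrable_atLeastAtMost') auto

lemma indicator_shift:
  "indicat_real ((\<lambda>s. T + s) ` A) (T + s) = indicat_real A (s::real)"
  by (auto simp: indicator_def)

lemma set_integrable_shift:
  fixes f :: "real \<Rightarrow> real"
  shows "set_integrable lborel ((\<lambda>s. T + s) ` A) f \<longleftrightarrow> set_integrable lborel A (\<lambda>s. f (T + s))"
  unfolding set_integrable_def
  using lborel_integrable_real_affine_iff[of 1 "\<lambda>x. indicator ((\<lambda>s. T + s) ` A) x *\<^sub>R f x" T]
  by (simp add: indicator_shift)

lemma set_integral_shift:
  fixes f :: "real \<Rightarrow> real"
  shows "(LINT s:((\<lambda>s. T + s) ` A)|lborel. f s) = (LINT s:A|lborel. f (T + s))"
  unfolding set_lebesgue_integral_def
  using lborel_integral_real_affine[of 1 "\<lambda>x. indicator ((\<lambda>s. T + s) ` A) x *\<^sub>R f x" T]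
  by (simp add: indicator_shift)

lemma set_integral_FTC_Icc:
  fixes F f :: "real \<Rightarrow> real"
  assumes "s \<le> t" and "\<And>x. (F has_real_derivative f x) (at x)" and "continuous_on UNIV f"
  shows "(LINT x:{s..t}|lborel. f x) = F t - F s"
  using integral_FTC_Icc_real[of s t F f] assms
  by (simp add: set_lebesgue_integral_def continuous_on_eq_continuous_at mult.commute)

text \<open>
  A substitute for the chain rule along absolutely continuous functions. If the increments of
  \<open>D\<close> over all sufficiently short intervals are at most \<open>e\<close> times those of \<open>K\<close>, then so is the
  total increment, by subdivision; and \<open>e\<close> is arbitrary.
\<close>

lemma increment_bound_local_to_global:
  fixes D K :: "real \<Rightarrow> real"
  assumes T: "0 \<le> T"
    and loc: "\<And>e. e > 0 \<Longrightarrow> \<exists>d>0. \<forall>s t. 0 \<le> s \<longrightarrow> s \<le> t \<longrightarrow> t \<le> T \<longrightarrow> t - s \<le> d \<longrightarrow>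
                D t - D s \<le> e * (K t - K s)"
  shows "D T \<le> D 0"
proof -
  have bound: "D T - D 0 \<le> e * (K T - K 0)" if e: "e > 0" for e
  proof -
    obtain d where d: "d > 0"
      and D: "\<And>s t. 0 \<le> s \<Longrightarrow> s \<le> t \<Longrightarrow> t \<le> T \<Longrightarrow> t - s \<le> d \<Longrightarrow> D t - D s \<le> e * (K t - K s)"
      using loc[OF e] by blast
    have "0 \<le> t \<Longrightarrow> t \<le> T \<Longrightarrow> t \<le> real n * d \<Longrightarrow> D t - D 0 \<le> e * (K t - K 0)" for n t
    proof (induction n arbitrary: t)
      case 0
      then show ?case by (simp)
    next
      case (Suc n)
      let ?s = "max 0 (t - d)"
      have "D ?s - D 0 \<le> e * (K ?s - K 0)"
        using Suc.prems d by (intro Suc.IH) (auto simp: algebra_simps)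
      moreover have "D t - D ?s \<le> e * (K t - K ?s)"
        using Suc.prems d by (intro D) auto
      ultimately show ?case by (simp add: algebra_simps)
    qed
    moreover obtain n :: nat where "T \<le> real n * d"
      using reals_Archimedean3[OF d] by (meson less_imp_le)
    ultimately show ?thesis using T by blast
  qed
  have "D T - D 0 \<le> 0"
  proof (rule field_le_epsilon)
    fix e :: real assume "e > 0"
    then have "D T - D 0 \<le> e / (\<bar>K T - K 0\<bar> + 1) * (K T - K 0)"
      by (intro bound) auto
    also have "\<dots> \<le> e / (\<bar>K T - K 0\<bar> + 1) * (\<bar>K T - K 0\<bar> + 1)"
      using \<open>e > 0\<close> by (intro mult_left_mono) auto
    finally show "D T - D 0 \<le> 0 + e" by simp
  qed
  then show ?thesis by simp
qed

text \<open>
  Writing \<open>exp (- \<rho> t)\<close> as the integral of \<open>\<rho> exp (- \<rho> s)\<close> over \<open>s \<ge> t\<close> and exchanging the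
  integrations reduces the discounted integral to the integrals of \<open>f\<close> over \<open>[0,s]\<close>.
\<close>

lemma discounted_integral_bound:
  fixes f :: "real \<Rightarrow> real"
  assumes \<rho>: "\<rho> > 0" and f0: "\<And>t. t \<ge> 0 \<Longrightarrow> f t \<ge> 0"
    and int: "\<And>T. T \<ge> 0 \<Longrightarrow> set_integrable lborel {0..T} f"
    and meas: "set_borel_measurable lborel {0..} f"
    and bound: "\<And>T. T \<ge> 0 \<Longrightarrow> (LINT t:{0..T}|lborel. f t) \<le> A + B * T" and A: "A \<ge> 0" and B: "B \<ge> 0"
  shows "set_integrable lborel {0..} (\<lambda>t. exp (- \<rho> * t) * f t)"
    and "(LINT t:{0..}|lborel. exp (- \<rho> * t) * f t) \<le> A + B / \<rho>"
proof -
  define g where "g t = indicat_real {0..} t * f t" for t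
  have g[measurable]: "g \<in> borel_measurable borel"
    using meas by (simp add: set_borel_measurable_def g_def[abs_def])
  have g0: "g t \<ge> 0" for t using f0 by (auto simp: g_def indicator_def)
  have tail: "ennreal (exp (- \<rho> * t)) = (\<integral>\<^sup>+s. ennreal (\<rho> * exp (- \<rho> * s)) * indicator {t..} s \<partial>lborel)"
    for t
  proof -
    have "(\<integral>\<^sup>+s. ennreal (\<rho> * exp (- \<rho> * s)) * indicator {t..} s \<partial>lborel)
        = ennreal (0 - (- exp (- \<rho> * t)))"
    proof (rule nn_integral_FTC_atLeast)
      show "((\<lambda>s. - exp (- \<rho> * s)) \<longlongrightarrow> 0) at_top"
        using \<rho> by real_asymp
    qed (use \<rho> in \<open>auto intro!: derivative_eq_intros\<close>)
    then show ?thesis by simp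
  qed
  have inner: "(\<integral>\<^sup>+t. ennreal (g t) * indicator {..s} t \<partial>lborel) \<le> ennreal (A + B * s)" if "s \<ge> 0" for s
  proof -
    have "integrable lborel (\<lambda>t. indicat_real {0..s} t *\<^sub>R f t)"
      using int[OF that] by (simp add: set_integrable_def)
    then have "(\<integral>\<^sup>+t. ennreal (indicat_real {0..s} t *\<^sub>R f t) \<partial>lborel)
        = ennreal (LINT t:{0..s}|lborel. f t)"
      unfolding set_lebesgue_integral_def
      by (intro nn_integral_eq_integral) (auto simp: indicator_def f0)
    moreover have "(\<lambda>t. ennreal (indicat_real {0..s} t *\<^sub>R f t)) = (\<lambda>t. ennreal (g t) * indicator {..s} t)"
      by (auto simp: g_def indicator_def)
    ultimately show ?thesis using bound[OF that] by (simp add: ennreal_leI)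
  qed
  have "(\<integral>\<^sup>+t. ennreal (exp (- \<rho> * t) * g t) \<partial>lborel)
      = (\<integral>\<^sup>+t. \<integral>\<^sup>+s. ennreal (\<rho> * exp (- \<rho> * s)) * ennreal (g t) * indicator {t..} s \<partial>lborel \<partial>lborel)"
  proof (rule nn_integral_cong)
    fix t :: real
    have "ennreal (exp (- \<rho> * t) * g t)
        = ennreal (g t) * (\<integral>\<^sup>+s. ennreal (\<rho> * exp (- \<rho> * s)) * indicator {t..} s \<partial>lborel)"
      by (subst tail[symmetric]) (simp add: ennreal_mult[symmetric] g0 mult.commute)
    also have "\<dots> = (\<integral>\<^sup>+s. ennreal (g t) * (ennreal (\<rho> * exp (- \<rho> * s)) * indicator {t..} s) \<partial>lborel)"
      by (rule nn_integral_cmult[symmetric]) measurable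
    finally show "ennreal (exp (- \<rho> * t) * g t)
        = (\<integral>\<^sup>+s. ennreal (\<rho> * exp (- \<rho> * s)) * ennreal (g t) * indicator {t..} s \<partial>lborel)"
      by (simp add: ac_simps)
  qed
  also have "\<dots> = (\<integral>\<^sup>+t. \<integral>\<^sup>+s. ennreal (\<rho> * exp (- \<rho> * s)) * ennreal (g t)
      * indicator {x :: real \<times> real. fst x \<le> snd x} (t, s) \<partial>lborel \<partial>lborel)"
    by (intro nn_integral_cong) (auto simp: indicator_def)
  also have "\<dots> = (\<integral>\<^sup>+s. \<integral>\<^sup>+t. ennreal (\<rho> * exp (- \<rho> * s)) * ennreal (g t)
      * indicator {x :: real \<times> real. fst x \<le> snd x} (t, s) \<partial>lborel \<partial>lborel)"
    by (rule lborel_pair.Fubini') measurable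
  also have "\<dots> = (\<integral>\<^sup>+s. \<integral>\<^sup>+t. ennreal (\<rho> * exp (- \<rho> * s)) * (ennreal (g t) * indicator {..s} t) \<partial>lborel \<partial>lborel)"
    by (intro nn_integral_cong) (auto simp: indicator_def)
  also have "\<dots> = (\<integral>\<^sup>+s. ennreal (\<rho> * exp (- \<rho> * s)) * (\<integral>\<^sup>+t. ennreal (g t) * indicator {..s} t \<partial>lborel) \<partial>lborel)"
    by (intro nn_integral_cong nn_integral_cmult) measurable
  also have "\<dots> \<le> (\<integral>\<^sup>+s. ennreal (\<rho> * exp (- \<rho> * s) * (A + B * s)) * indicator {0..} s \<partial>lborel)"
  proof (intro nn_integral_mono)
    fix s :: real
    show "ennreal (\<rho> * exp (- \<rho> * s)) * (\<integral>\<^sup>+t. ennreal (g t) * indicator {..s} t \<partial>lborel)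
        \<le> ennreal (\<rho> * exp (- \<rho> * s) * (A + B * s)) * indicator {0..} s"
    proof (cases "s \<ge> 0")
      case True
      then show ?thesis using inner[OF True] \<rho> A B
        by (simp add: ennreal_mult mult_left_mono)
    next
      case False
      then have "(\<lambda>t. ennreal (g t) * indicator {..s} t) = (\<lambda>t. 0)"
        by (auto simp: g_def indicator_def)
      then show ?thesis using False by simp
    qed
  qed
  also have "\<dots> = ennreal (0 - (- (A + B / \<rho>) * exp (- \<rho> * 0) - B * (0 * exp (- \<rho> * 0))))"
  proof (rule nn_integral_FTC_atLeast)
    have lims: "((\<lambda>s. exp (- \<rho> * s)) \<longlongrightarrow> 0) at_top" "((\<lambda>s. s * exp (- \<rho> * s)) \<longlongrightarrow> 0) at_top"
      using \<rho> by real_asymp+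
    show "((\<lambda>s. - (A + B / \<rho>) * exp (- \<rho> * s) - B * (s * exp (- \<rho> * s))) \<longlongrightarrow> 0) at_top"
      using tendsto_diff[OF tendsto_mult[OF tendsto_const lims(1)] tendsto_mult[OF tendsto_const lims(2)],
          of "- (A + B / \<rho>)" B] by simp
  qed (use \<rho> A B in \<open>auto intro!: derivative_eq_intros simp: field_simps\<close>)
  finally have fin: "(\<integral>\<^sup>+t. ennreal (exp (- \<rho> * t) * g t) \<partial>lborel) \<le> ennreal (A + B / \<rho>)"
    by (simp add: add.commute)
  have eq: "(\<lambda>t. indicat_real {0..} t *\<^sub>R (exp (- \<rho> * t) * f t)) = (\<lambda>t. exp (- \<rho> * t) * g t)"
    by (auto simp: g_def)
  have "integrable lborel (\<lambda>t. exp (- \<rho> * t) * g t)"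
    using fin g0 by (intro integrableI_nonneg) (auto simp: less_top[symmetric] top_unique)
  then show "set_integrable lborel {0..} (\<lambda>t. exp (- \<rho> * t) * f t)"
    unfolding set_integrable_def eq .
  have "integral\<^sup>L lborel (\<lambda>t. exp (- \<rho> * t) * g t) \<le> A + B / \<rho>"
    using fin g0 \<rho> A B by (intro integral_real_bounded) auto
  then show "(LINT t:{0..}|lborel. exp (- \<rho> * t) * f t) \<le> A + B / \<rho>"
    unfolding set_lebesgue_integral_def eq .
qed

lemma set_borel_measurable_half_line:
  fixes f :: "real \<Rightarrow> real"
  assumes "\<And>T. 0 \<le> T \<Longrightarrow> set_integrable lborel {0..T} f"
  shows "set_borel_measurable lborel {0..} f"
  unfolding set_borel_measurable_def
proof (rule borel_measurable_LIMSEQ_real)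
  fix t :: real
  obtain N :: nat where "t \<le> real N" using real_arch_simple by blast
  then have "\<forall>n\<ge>N. indicat_real {0..real n} t *\<^sub>R f t = indicat_real {0..} t *\<^sub>R f t"
    by (auto simp: indicator_def)
  then show "(\<lambda>n. indicat_real {0..real n} t *\<^sub>R f t) \<longlonglongrightarrow> indicat_real {0..} t *\<^sub>R f t"
    by (metis (mono_tags, lifting) eventually_sequentiallyI tendsto_eventually)
next
  fix n :: nat
  show "(\<lambda>t. indicat_real {0..real n} t *\<^sub>R f t) \<in> borel_measurable lborel"
    using assms[of "real n"] unfolding set_integrable_def by (intro borel_measurable_integrable) auto
qed

lemma continuous_on_half_line:
  fixes f :: "real \<Rightarrow> real"
  assumes "\<And>T. 0 \<le> T \<Longrightarrow> continuous_on {0..T} f"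
  shows "continuous_on {0..} f"
  unfolding continuous_on_def
proof
  fix t :: real assume t: "t \<in> {0..}"
  have "continuous_on {0..t+1} f" using assms t by auto
  then have "(f \<longlongrightarrow> f t) (at t within {0..t+1})" using t by (auto simp: continuous_on_def)
  moreover have "at t within {0..t+1} = at t within {0..}"
    using t by (intro at_within_nhd[of _ "{..<t+1}"]) auto
  ultimately show "(f \<longlongrightarrow> f t) (at t within {0..})" by simp
qed

lemma set_integral_half_line_split:
  fixes f :: "real \<Rightarrow> real"
  assumes "set_integrable lborel {0..} f" "0 \<le> T"
  shows "(LINT t:{0..}|lborel. f t) = (LINT t:{0..T}|lborel. f t) + (LINT t:{T..}|lborel. f t)"
proof -
  have un: "{0..} = {0..T} \<union> {T..}" using assms(2) by auto
  have "AE t in lborel. t \<noteq> T" by (rule AE_lborel_singleton)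
  then have "AE t in lborel. \<not> (t \<in> {0..T} \<and> t \<in> {T..})"
    by eventually_elim auto
  then show ?thesis
    unfolding un using assms by (intro set_integral_Un_AE) (auto intro: set_integrable_subset)
qed

lemma discount_integrable: "\<rho> > 0 \<Longrightarrow> set_integrable lborel {0..} (\<lambda>t. exp (- \<rho> * t) * (k::real))"
  and discount_integral_le: "\<rho> > 0 \<Longrightarrow> 0 \<le> k \<Longrightarrow> (LINT t:{0..}|lborel. exp (- \<rho> * t) * k) \<le> k / \<rho>"
proof -
  have meas: "set_borel_measurable lborel {0..} (\<lambda>t::real. k)" for k :: real
    by (simp add: set_borel_measurable_def)
  have *: "set_integrable lborel {0..} (\<lambda>t. exp (- \<rho> * t) * (k::real))"
     "(LINT t:{0..}|lborel. exp (- \<rho> * t) * k) \<le> k / \<rho>" if "\<rho> > 0" "0 \<le> k" for k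
    using discounted_integral_bound[of \<rho> "\<lambda>_. k" 0 k] that meas
    by (simp_all add: set_integral_Icc_const set_integrable_Icc_const mult.commute)
  show "set_integrable lborel {0..} (\<lambda>t. exp (- \<rho> * t) * (k::real))" if "\<rho> > 0"
    using set_integrable_mult_right[OF *(1)[OF that, of 1], of k] by (simp add: mult.commute)
  show "(LINT t:{0..}|lborel. exp (- \<rho> * t) * k) \<le> k / \<rho>" if "\<rho> > 0" "0 \<le> k"
    using *(2) that .
qed

text \<open>
  The lower bound is \<open>exp (- s) \<le> 1 / (1 + s) \<le> 1 - s + s\<^sup>2\<close>.
\<close>

lemma one_minus_exp_bounds:
  fixes s :: real
  assumes "0 \<le> s"
  shows "s - s\<^sup>2 \<le> 1 - exp (- s)" "1 - exp (- s) \<le> s"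
proof -
  have "1 \<le> (1 - s + s\<^sup>2) * (1 + s)"
    using assms by (simp add: algebra_simps power2_eq_square power3_eq_cube)
  also have "\<dots> \<le> (1 - s + s\<^sup>2) * exp s"
  proof (rule mult_left_mono)
    have "0 \<le> (1 - s / 2)\<^sup>2 + 3 / 4 * s\<^sup>2" by simp
    then show "0 \<le> 1 - s + s\<^sup>2" by (simp add: power2_eq_square algebra_simps)
  qed (rule exp_ge_add_one_self)
  finally have "exp (- s) \<le> 1 - s + s\<^sup>2" by (simp add: exp_minus field_simps)
  then show "s - s\<^sup>2 \<le> 1 - exp (- s)" by simp
  show "1 - exp (- s) \<le> s" using exp_ge_add_one_self[of "- s"] by simp
qed

lemma continuous_near_left_end:
  fixes f :: "real \<Rightarrow> real"
  assumes "continuous_on {0..T} f" "0 < T" "0 < e"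
  obtains d where "0 < d" "d \<le> T" "\<And>t. 0 \<le> t \<Longrightarrow> t \<le> d \<Longrightarrow> \<bar>f t - f 0\<bar> \<le> e"
proof -
  obtain d where d: "0 < d" "\<And>t. t \<in> {0..T} \<Longrightarrow> \<bar>t\<bar> < d \<Longrightarrow> \<bar>f t - f 0\<bar> < e"
    using assms unfolding continuous_on_iff dist_real_def by force
  show ?thesis
    by (rule that[of "min (d / 2) T"]) (use d assms(2) in \<open>auto intro!: less_imp_le\<close>)
qed

text \<open>
  The exit time from a ball, capped at the horizon \<open>D\<close>.
\<close>

lemma first_exit_time:
  fixes X :: "real \<Rightarrow> real"
  assumes X: "continuous_on {0..D} X" and D: "0 \<le> D" and R: "0 < R"
  obtains T where "0 \<le> T" "T \<le> D" "\<And>s. 0 \<le> s \<Longrightarrow> s \<le> T \<Longrightarrow> \<bar>X s - X 0\<bar> \<le> R"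
    "T = D \<or> \<bar>X T - X 0\<bar> = R"
proof (cases "\<forall>s\<in>{0..D}. \<bar>X s - X 0\<bar> \<le> R")
  case True
  then show ?thesis using that[of D] D by auto
next
  case False
  define E where "E = {s \<in> {0..D}. R \<le> \<bar>X s - X 0\<bar>}"
  have cont: "continuous_on {0..D} (\<lambda>s. \<bar>X s - X 0\<bar>)" using X by (intro continuous_intros)
  have "E = {0..D} \<inter> (\<lambda>s. \<bar>X s - X 0\<bar>) -` {R..}" by (auto simp: E_def)
  then have "compact E"
    using continuous_closed_preimage[OF cont] by (simp add: compact_eq_bounded_closed bounded_Int)
  then obtain T where T: "T \<in> E" "\<And>s. s \<in> E \<Longrightarrow> T \<le> s"
    using False compact_attains_inf[of E] by (force simp: E_def)
  have below: "\<bar>X s - X 0\<bar> < R" if "0 \<le> s" "s < T" for s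
    using T that by (force simp: E_def)
  have "\<exists>s. 0 \<le> s \<and> s \<le> T \<and> \<bar>X s - X 0\<bar> = R"
    using T R by (intro IVT') (auto simp: E_def intro: continuous_on_subset[OF cont])
  then have "\<bar>X T - X 0\<bar> = R" using below by force
  then show ?thesis using T below by (intro that[of T]) (force simp: E_def order.order_iff_strict)+
qed

lemma continuous_uniform_near_initial:
  fixes f :: "real \<times> real \<Rightarrow> real"
  assumes "continuous_on ({0..} \<times> {0..}) f" "0 \<le> x" "0 < e"
  obtains d where "0 < d" "\<And>s y. 0 \<le> s \<Longrightarrow> s \<le> d \<Longrightarrow> 0 \<le> y \<Longrightarrow> \<bar>y - x\<bar> \<le> d \<Longrightarrow> \<bar>f (s, y) - f (0, x)\<bar> \<le> e"
proof -
  obtain d where d: "0 < d" "\<And>p. p \<in> {0..} \<times> {0..} \<Longrightarrow> dist p (0, x) < d \<Longrightarrow> dist (f p) (f (0, x)) < e"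
    using assms unfolding continuous_on_iff by force
  show ?thesis
  proof (rule that[of "d / 3"])
    fix s y assume a: "0 \<le> s" "s \<le> d / 3" "0 \<le> y" "\<bar>y - x\<bar> \<le> d / 3"
    have "dist (s, y) (0, x) \<le> dist s 0 + dist y x"
      unfolding dist_Pair_Pair by (rule sqrt_sum_squares_le_sum) auto
    also have "\<dots> < d" using a d by (simp add: dist_real_def)
    finally show "\<bar>f (s, y) - f (0, x)\<bar> \<le> e" using d(2)[of "(s, y)"] a by (simp add: dist_real_def)
  qed (use d in simp)
qed

section \<open>Controlled paths of the lake\<close>

text \<open>
  What the deterministic problem uses of the recycling rate: besides monotonicity, a global
  Lipschitz constant and an upper bound.
\<close>

locale lake =
  fixes b c \<rho> :: real and r :: "real \<Rightarrow> real" and L a :: real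
  assumes b_pos: "0 < b" and c_pos: "0 < c" and \<rho>_pos: "0 < \<rho>" and L_pos: "0 < L"
    and r_0: "r 0 = 0"
    and r_mono: "0 \<le> x \<Longrightarrow> x \<le> y \<Longrightarrow> r x \<le> r y"
    and r_lipschitz: "L-lipschitz_on {0..} r"
    and r_le: "0 \<le> x \<Longrightarrow> r x \<le> a"
begin

lemma r_nonneg: "0 \<le> x \<Longrightarrow> 0 \<le> r x"
  using r_mono[of 0 x] r_0 by simp

lemma a_nonneg: "0 \<le> a"
  using r_le[of 0] r_0 by simp

lemma r_continuous: "continuous_on {0..} r"
  using r_lipschitz by (rule lipschitz_on_continuous_on)

lemma r_continuous_on_compose:
  assumes "continuous_on S X" "\<And>t. t \<in> S \<Longrightarrow> 0 \<le> X t"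
  shows "continuous_on S (\<lambda>t. r (X t))"
  using assms by (intro continuous_on_compose2[OF r_continuous]) auto

lemma r_increment: "0 \<le> x \<Longrightarrow> 0 \<le> y \<Longrightarrow> \<bar>r x - r y\<bar> \<le> L * \<bar>x - y\<bar>"
  using lipschitz_onD[OF r_lipschitz, of x y] by (simp add: dist_real_def)

definition drift :: "(real \<Rightarrow> real) \<Rightarrow> (real \<Rightarrow> real) \<Rightarrow> real \<Rightarrow> real" where
  "drift u X s = u s - b * X s + r (X s)"

text \<open>
  The control is not required to be positive here: the pair \<open>u = 0\<close>, \<open>X = 0\<close> is the starting
  point from which curves are built by perturbation.
\<close>

definition solves :: "real \<Rightarrow> real \<Rightarrow> (real \<Rightarrow> real) \<Rightarrow> (real \<Rightarrow> real) \<Rightarrow> bool" where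
  "solves T x u X \<longleftrightarrow>
     set_integrable lborel {0..T} u \<and> continuous_on {0..T} X \<and>
     (\<forall>t\<in>{0..T}. 0 \<le> X t \<and> X t = x + (LINT s:{0..t}|lborel. drift u X s))"

definition controlled_path :: "real \<Rightarrow> (real \<Rightarrow> real) \<Rightarrow> (real \<Rightarrow> real) \<Rightarrow> bool" where
  "controlled_path x u X \<longleftrightarrow> (\<forall>t\<ge>0. 0 < u t) \<and> (\<forall>T\<ge>0. solves T x u X)"

lemma solvesD:
  assumes "solves T x u X"
  shows "set_integrable lborel {0..T} u" "continuous_on {0..T} X"
    and "\<And>t. 0 \<le> t \<Longrightarrow> t \<le> T \<Longrightarrow> 0 \<le> X t"
    and "\<And>t. 0 \<le> t \<Longrightarrow> t \<le> T \<Longrightarrow> X t = x + (LINT s:{0..t}|lborel. drift u X s)"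
  using assms unfolding solves_def Ball_def atLeastAtMost_iff by blast+

lemma controlled_pathD:
  assumes "controlled_path x u X"
  shows "\<And>t. 0 \<le> t \<Longrightarrow> 0 < u t" "\<And>T. 0 \<le> T \<Longrightarrow> solves T x u X"
    and "\<And>t. 0 \<le> t \<Longrightarrow> 0 \<le> X t"
  using assms solvesD(3) unfolding controlled_path_def by blast+

lemma drift_integrable:
  assumes "solves T x u X"
  shows "set_integrable lborel {0..T} (drift u X)"
proof -
  have "set_integrable lborel {0..T} (\<lambda>s. u s + (- b * X s + r (X s)))"
    using solvesD(2,3)[OF assms]
    by (intro set_integral_add(1)[OF solvesD(1)[OF assms] borel_integrable_atLeastAtMost']
        continuous_intros r_continuous_on_compose) auto
  then show ?thesis by (simp add: drift_def[abs_def] algebra_simps)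
qed

lemma solves_initial: "solves T x u X \<Longrightarrow> 0 \<le> T \<Longrightarrow> X 0 = x"
  using solvesD(4)[of T x u X 0] set_borel_integral_eq_integral(2)[of "{0..0}" "drift u X"]
    set_integrable_Icc_sub[OF drift_integrable, of T x u X 0 0]
  by (simp add: integral_refl)

lemma solves_increment:
  assumes "solves T x u X" "0 \<le> s" "s \<le> t" "t \<le> T"
  shows "X t - X s = (LINT v:{s..t}|lborel. drift u X v)"
  using solvesD(4)[OF assms(1), of s] solvesD(4)[OF assms(1), of t] assms
    set_integral_Icc_combine[OF set_integrable_Icc_sub[OF drift_integrable[OF assms(1)]], of 0 t s]
  by simp

lemma control_integral:
  assumes "solves T x u X" "0 \<le> s" "s \<le> t" "t \<le> T"
  shows "(LINT v:{s..t}|lborel. u v) = X t - X s + (LINT v:{s..t}|lborel. b * X v - r (X v))"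
proof -
  note sub = set_integrable_Icc_sub[OF _ \<open>0 \<le> s\<close> \<open>t \<le> T\<close>]
  have "set_integrable lborel {0..T} (\<lambda>v. b * X v - r (X v))"
    using solvesD[OF assms(1)]
    by (intro borel_integrable_atLeastAtMost' continuous_intros r_continuous_on_compose) auto
  then have "(LINT v:{s..t}|lborel. drift u X v) + (LINT v:{s..t}|lborel. b * X v - r (X v))
      = (LINT v:{s..t}|lborel. drift u X v + (b * X v - r (X v)))"
    using drift_integrable[OF assms(1)] by (intro set_integral_add(2)[symmetric] sub)
  also have "\<dots> = (LINT v:{s..t}|lborel. u v)"
    by (simp add: drift_def)
  finally show ?thesis using solves_increment[OF assms] by simp
qed

subsection \<open>Building paths\<close>

lemma solves_mono: "solves T x u X \<Longrightarrow> t \<le> T \<Longrightarrow> solves t x u X"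
  unfolding solves_def Ball_def atLeastAtMost_iff
  by (meson set_integrable_Icc_sub continuous_on_subset atLeastatMost_subset_iff order.refl order.trans)

lemma solves_shift:
  assumes "solves (T + h) x u X" "0 \<le> T" "0 \<le> h"
  shows "solves h (X T) (\<lambda>t. u (T + t)) (\<lambda>t. X (T + t))"
  unfolding solves_def
proof (intro conjI ballI)
  have im: "(+) T ` {0..t} = {T..T + t}" for t
    by (simp add: image_add_atLeastAtMost)
  show "set_integrable lborel {0..h} (\<lambda>t. u (T + t))"
    using set_integrable_shift[of T "{0..h}" u] solvesD(1)[OF assms(1)] assms(2)
    by (simp add: im set_integrable_Icc_sub)
  show "continuous_on {0..h} (\<lambda>t. X (T + t))"
    using assms(2) by (intro continuous_on_compose2[OF solvesD(2)[OF assms(1)]] continuous_intros) auto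
  fix t assume t: "t \<in> {0..h}"
  then show "0 \<le> X (T + t)" using solvesD(3)[OF assms(1)] assms by auto
  have "drift (\<lambda>t. u (T + t)) (\<lambda>t. X (T + t)) = (\<lambda>s. drift u X (T + s))"
    by (simp add: drift_def fun_eq_iff)
  then show "X (T + t) = X T + (LINT s:{0..t}|lborel. drift (\<lambda>t. u (T + t)) (\<lambda>t. X (T + t)) s)"
    using solves_increment[OF assms(1), of T "T + t"] assms t set_integral_shift[of T "{0..t}" "drift u X"]
    by (simp add: im algebra_simps)
qed

text \<open>
  At the switching time the first function counts. For states the two values agree there; for
  controls and rewards a single time is negligible.
\<close>

definition glue :: "real \<Rightarrow> (real \<Rightarrow> real) \<Rightarrow> (real \<Rightarrow> real) \<Rightarrow> real \<Rightarrow> real" where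
  "glue T f g t = (if t \<le> T then f t else g (t - T))"

lemma set_integrable_glue:
  assumes "set_integrable lborel {0..T} f" "set_integrable lborel A g" "0 \<le> T" "A \<subseteq> {0..}"
    and A: "A \<in> sets borel"
  shows "set_integrable lborel ({0..T} \<union> (+) T ` A) (glue T f g)"
proof -
  have "set_integrable lborel {0..T} (glue T f g)"
    using assms(1) by (rule set_integrable_cong[THEN iffD1, rotated 3]) (auto simp: glue_def)
  moreover have "set_integrable lborel (A - {0}) g"
    using assms by (intro set_integrable_subset[OF assms(2)]) auto
  then have "set_integrable lborel ((+) T ` (A - {0})) (glue T f g)"
    unfolding set_integrable_shift
    by (rule set_integrable_cong[THEN iffD1, rotated 3]) (use assms(4) in \<open>auto simp: glue_def\<close>)
  moreover have "{0..T} \<union> (+) T ` A = {0..T} \<union> (+) T ` (A - {0})"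
    using assms(3) by auto
  moreover have "(+) T ` (A - {0}) \<in> sets borel"
  proof -
    have "(+) T ` (A - {0}) = (\<lambda>x. x - T) -` (A - {0}) \<inter> space borel"
      by (auto intro!: image_eqI[of _ "(+) T" "_ - T"])
    also have "\<dots> \<in> sets borel" using A by (intro measurable_sets[of _ _ borel]) auto
    finally show ?thesis .
  qed
  ultimately show ?thesis by (simp add: set_integrable_Un)
qed

lemma set_integral_glue_tail:
  assumes g: "set_integrable lborel A g" and A: "A \<subseteq> {0..}"
  shows "(LINT s:A|lborel. glue T f g (T + s)) = (LINT s:A|lborel. g s)"
proof -
  have split: "(\<lambda>s. indicat_real A s *\<^sub>R glue T f g (T + s))
      = (\<lambda>s. indicat_real A s *\<^sub>R g s + indicat_real A 0 * (f T - g 0) * indicator {0} s)"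
    using A by (auto simp: glue_def indicator_def fun_eq_iff subset_iff)
  have "AE s in lborel. s \<noteq> (0::real)" by (rule AE_lborel_singleton)
  then have "AE s in lborel. indicat_real A s *\<^sub>R g s + indicat_real A 0 * (f T - g 0) * indicator {0} s
      = indicat_real A s *\<^sub>R g s"
    by eventually_elim auto
  then show ?thesis
    unfolding set_lebesgue_integral_def split
    by (intro integral_cong_AE borel_measurable_add
        borel_measurable_integrable[OF g[unfolded set_integrable_def]]) auto
qed

lemma solves_glue:
  assumes 1: "solves T x u X" and 2: "solves h (X T) v Y" and "0 \<le> T" "0 \<le> h"
  shows "solves (T + h) x (glue T u v) (glue T X Y)"
proof -
  have Y0: "Y 0 = X T" using solves_initial[OF 2 \<open>0 \<le> h\<close>] .
  have im: "(+) T ` {0..t} = {T..T + t}" for t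
    by (simp add: image_add_atLeastAtMost)
  have un: "{0..T + h} = {0..T} \<union> (+) T ` {0..h}" using assms(3,4) by (auto simp: im)
  have int_u: "set_integrable lborel {0..T + h} (glue T u v)"
    unfolding un using solvesD(1)[OF 1] solvesD(1)[OF 2] assms by (intro set_integrable_glue) auto
  have d_eq: "drift (glue T u v) (glue T X Y) = glue T (drift u X) (drift v Y)"
    by (auto simp: drift_def glue_def fun_eq_iff)
  have int_d: "set_integrable lborel {0..T + h} (glue T (drift u X) (drift v Y))"
    unfolding un using drift_integrable[OF 1] drift_integrable[OF 2] assms by (intro set_integrable_glue) auto
  have cont: "continuous_on {0..T + h} (glue T X Y)"
  proof -
    have "continuous_on ({0..T} \<union> {T..T + h}) (\<lambda>t. if t \<le> T then X t else Y (t - T))"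
      using solvesD(2)[OF 1] Y0
      by (intro continuous_on_If continuous_on_compose2[OF solvesD(2)[OF 2]] continuous_intros) auto
    moreover have "{0..T} \<union> {T..T + h} = {0..T + h}" using assms(3,4) by auto
    ultimately show ?thesis by (simp only: glue_def[abs_def])
  qed
  have pre: "(LINT s:{0..t}|lborel. glue T (drift u X) (drift v Y) s) = (LINT s:{0..t}|lborel. drift u X s)"
    if "t \<le> T" for t
    using that by (intro set_lebesgue_integral_cong) (auto simp: glue_def)
  have post: "(LINT s:{T..T + t}|lborel. glue T (drift u X) (drift v Y) s) = (LINT s:{0..t}|lborel. drift v Y s)"
    if "0 \<le> t" "t \<le> h" for t
  proof -
    have "(LINT s:{T..T + t}|lborel. glue T (drift u X) (drift v Y) s)
        = (LINT s:{0..t}|lborel. glue T (drift u X) (drift v Y) (T + s))"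
      using set_integral_shift[of T "{0..t}" "glue T (drift u X) (drift v Y)"] by (simp add: im algebra_simps)
    also have "\<dots> = (LINT s:{0..t}|lborel. drift v Y s)"
      using that by (intro set_integral_glue_tail set_integrable_Icc_sub[OF drift_integrable[OF 2]]) auto
    finally show ?thesis .
  qed
  show ?thesis
    unfolding solves_def d_eq
  proof (intro conjI ballI int_u cont)
    fix t assume t: "t \<in> {0..T + h}"
    show "0 \<le> glue T X Y t"
      using solvesD(3)[OF 1] solvesD(3)[OF 2] t by (auto simp: glue_def)
    show "glue T X Y t = x + (LINT s:{0..t}|lborel. glue T (drift u X) (drift v Y) s)"
    proof (cases "t \<le> T")
      case True
      then show ?thesis using pre[OF True] solvesD(4)[OF 1, of t] t by (simp add: glue_def)
    next
      case False
      then have "(LINT s:{0..t}|lborel. glue T (drift u X) (drift v Y) s)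
          = (LINT s:{0..T}|lborel. drift u X s) + (LINT s:{0..t - T}|lborel. drift v Y s)"
        using set_integral_Icc_combine[OF set_integrable_Icc_sub[OF int_d], of 0 t T] pre[of T]
          post[of "t - T"] t assms by simp
      then show ?thesis
        using False solvesD(4)[OF 1, of T] solvesD(4)[OF 2, of "t - T"] t assms by (simp add: glue_def)
    qed
  qed
qed

text \<open>
  The way in which every new path arises: prescribe the displacement \<open>Z\<close> of the state and read
  off the control from the state equation.
\<close>

lemma solves_perturb:
  assumes sol: "solves T x u X"
    and Z: "\<And>t. (Z has_real_derivative z t) (at t)" and z: "continuous_on UNIV z"
    and nonneg: "\<And>t. 0 \<le> t \<Longrightarrow> t \<le> T \<Longrightarrow> 0 \<le> X t + Z t"
  shows "solves T (x + Z 0) (\<lambda>t. u t + (z t + b * Z t + r (X t) - r (X t + Z t))) (\<lambda>t. X t + Z t)"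
    (is "solves T _ ?w ?Y")
proof -
  have contZ: "continuous_on S Z" for S
    by (meson DERIV_continuous_on Z has_field_derivative_at_within)
  have contz: "continuous_on S z" for S
    using z continuous_on_subset by blast
  have cont: "continuous_on {0..T} (\<lambda>t. z t + b * Z t + r (X t) - r (X t + Z t))"
    using solvesD(2,3)[OF sol] nonneg
    by (intro continuous_intros contZ contz r_continuous_on_compose) auto
  have "set_integrable lborel {0..T} ?w"
    by (intro set_integral_add(1)[OF solvesD(1)[OF sol] borel_integrable_atLeastAtMost'] cont)
  moreover have "continuous_on {0..T} ?Y"
    using solvesD(2)[OF sol] by (intro continuous_intros contZ)
  moreover have "?Y t = x + Z 0 + (LINT s:{0..t}|lborel. drift ?w ?Y s)" if "t \<in> {0..T}" for t
  proof -
    have "(LINT s:{0..t}|lborel. drift ?w ?Y s) = (LINT s:{0..t}|lborel. drift u X s + z s)"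
      by (simp add: drift_def algebra_simps)
    also have "\<dots> = (LINT s:{0..t}|lborel. drift u X s) + (LINT s:{0..t}|lborel. z s)"
      using that
      by (intro set_integral_add(2) set_integrable_Icc_sub[OF drift_integrable[OF sol]]
          borel_integrable_atLeastAtMost'[OF contz]) auto
    also have "(LINT s:{0..t}|lborel. z s) = Z t - Z 0"
      using that by (intro set_integral_FTC_Icc Z z) auto
    finally show ?thesis using solvesD(4)[OF sol, of t] that by simp
  qed
  ultimately show ?thesis using nonneg by (auto simp: solves_def)
qed

lemma solves_zero: "0 \<le> T \<Longrightarrow> solves T 0 (\<lambda>_. 0) (\<lambda>_. 0)"
  by (auto simp: solves_def drift_def r_0 set_integrable_def)

lemma solves_curve:
  assumes "0 \<le> T" and Z: "\<And>t. (Z has_real_derivative z t) (at t)" and z: "continuous_on UNIV z"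
    and nonneg: "\<And>t. 0 \<le> t \<Longrightarrow> t \<le> T \<Longrightarrow> 0 \<le> Z t"
  shows "solves T (Z 0) (\<lambda>t. z t + b * Z t - r (Z t)) Z"
  using solves_perturb[OF solves_zero[OF \<open>0 \<le> T\<close>] Z z] nonneg by (simp add: r_0)

text \<open>
  Gronwall's argument: the distance \<open>D\<close> of two solutions is at most \<open>(b + L)\<close> times its own
  integral \<open>I\<close>, so \<open>exp (- (b + L) t) I t\<close> is non-increasing, and it starts at \<open>0\<close>.
\<close>

lemma solves_unique:
  assumes X: "solves T x u X" and Y: "solves T x u Y" and "0 \<le> T"
  shows "X T = Y T"
proof -
  define D where "D t = \<bar>X t - Y t\<bar>" for t
  define I where "I t = integral {0..t} D" for t
  have contD: "continuous_on {0..T} D"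
    unfolding D_def[abs_def] using solvesD(2)[OF X] solvesD(2)[OF Y] by (intro continuous_intros)
  have D_le: "D t \<le> (b + L) * I t" if t: "0 \<le> t" "t \<le> T" for t
  proof -
    have contDt: "continuous_on {0..t} D" using contD t continuous_on_subset by force
    have intX: "set_integrable lborel {0..t} (drift u X)" and intY: "set_integrable lborel {0..t} (drift u Y)"
      using drift_integrable[OF X] drift_integrable[OF Y] t by (auto intro: set_integrable_Icc_sub)
    have "X t - Y t = (LINT s:{0..t}|lborel. drift u X s - drift u Y s)"
      using solvesD(4)[OF X t] solvesD(4)[OF Y t] intX intY by (simp add: set_integral_diff)
    then have "D t \<le> (LINT s:{0..t}|lborel. \<bar>drift u X s - drift u Y s\<bar>)"
      unfolding D_def using set_integral_norm_bound[OF set_integral_diff(1)[OF intX intY]] by simp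
    also have "\<dots> \<le> (LINT s:{0..t}|lborel. (b + L) * D s)"
    proof (intro set_integral_mono)
      show "set_integrable lborel {0..t} (\<lambda>s. \<bar>drift u X s - drift u Y s\<bar>)"
        using set_integral_diff(1)[OF intX intY] by (rule set_integrable_abs)
      show "set_integrable lborel {0..t} (\<lambda>s. (b + L) * D s)"
        using contDt by (intro borel_integrable_atLeastAtMost' continuous_intros)
      fix s assume "s \<in> {0..t}"
      then have s: "0 \<le> X s" "0 \<le> Y s" using solvesD(3)[OF X] solvesD(3)[OF Y] t by auto
      have "\<bar>drift u X s - drift u Y s\<bar> = \<bar>(r (X s) - r (Y s)) - b * (X s - Y s)\<bar>"
        by (simp add: drift_def algebra_simps)
      also have "\<dots> \<le> \<bar>r (X s) - r (Y s)\<bar> + b * \<bar>X s - Y s\<bar>"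
        using b_pos abs_triangle_ineq4[of "r (X s) - r (Y s)" "b * (X s - Y s)"] by (simp add: abs_mult)
      also have "\<dots> \<le> (b + L) * D s"
        using r_increment[OF s] by (simp add: D_def algebra_simps)
      finally show "\<bar>drift u X s - drift u Y s\<bar> \<le> (b + L) * D s" .
    qed
    also have "\<dots> = (b + L) * I t"
      using contDt by (simp add: I_def set_borel_integral_eq_integral borel_integrable_atLeastAtMost')
    finally show ?thesis .
  qed
  define E where "E t = exp (- (b + L) * t) * I t" for t
  have "E T \<le> E 0"
  proof (cases "T = 0")
    case False
    with \<open>0 \<le> T\<close> have "0 < T" by simp
    show ?thesis
    proof (rule DERIV_nonpos_imp_decreasing_open[OF \<open>0 \<le> T\<close>])
      fix t assume t: "0 < t" "t < T"
      have "(I has_real_derivative D t) (at t within {0..T})"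
        unfolding I_def[abs_def] using contD t integral_has_real_derivative[of 0 T D t] by auto
      then have "(I has_real_derivative D t) (at t)"
        using at_within_Icc_at[of 0 t T] t by simp
      then have "(E has_real_derivative exp (- (b + L) * t) * (D t - (b + L) * I t)) (at t)"
        unfolding E_def[abs_def] by (auto intro!: derivative_eq_intros simp: algebra_simps)
      moreover have "exp (- (b + L) * t) * (D t - (b + L) * I t) \<le> 0"
        using D_le[of t] t by (intro mult_nonneg_nonpos) auto
      ultimately show "\<exists>y. (E has_real_derivative y) (at t) \<and> y \<le> 0" by blast
    next
      show "continuous_on {0..T} E"
        unfolding E_def[abs_def] I_def[abs_def]
        by (intro continuous_intros indefinite_integral_continuous_1 integrable_continuous_interval contD)
    qed
  qed simp
  then have "I T \<le> 0"
    by (simp add: E_def I_def mult_le_0_iff)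
  then have "D T \<le> 0"
    using D_le[of T] \<open>0 \<le> T\<close> b_pos L_pos by (smt (verit) mult_nonneg_nonpos)
  then show ?thesis by (simp add: D_def)
qed

section \<open>The pathwise value function\<close>

definition reward :: "(real \<Rightarrow> real) \<Rightarrow> (real \<Rightarrow> real) \<Rightarrow> real \<Rightarrow> real" where
  "reward u X t = exp (- \<rho> * t) * (ln (u t) - c * (X t)\<^sup>2)"

definition payoff :: "(real \<Rightarrow> real) \<Rightarrow> (real \<Rightarrow> real) \<Rightarrow> real" where
  "payoff u X = (LINT t:{0..}|lborel. reward u X t)"

text \<open>
  Paths with an integrable reward. The others have benefit \<open>-\<infinity>\<close>, since the positive part of the
  reward always has a finite integral.
\<close>

definition regular_path :: "real \<Rightarrow> (real \<Rightarrow> real) \<Rightarrow> (real \<Rightarrow> real) \<Rightarrow> bool" where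
  "regular_path x u X \<longleftrightarrow> controlled_path x u X \<and> set_integrable lborel {0..} (reward u X)"

definition V :: "real \<Rightarrow> real" where
  "V x = Sup {payoff u X |u X. regular_path x u X}"

lemma controlled_path_continuous:
  assumes "controlled_path x u X"
  shows "continuous_on {0..} X"
  using solvesD(2)[OF controlled_pathD(2)[OF assms]] by (rule continuous_on_half_line)

lemma controlled_path_measurable:
  assumes "controlled_path x u X"
  shows "set_borel_measurable lborel {0..} u" and "set_borel_measurable lborel {0..} X"
proof -
  show "set_borel_measurable lborel {0..} u"
    using solvesD(1)[OF controlled_pathD(2)[OF assms]] by (rule set_borel_measurable_half_line)
  show "set_borel_measurable lborel {0..} X"
    using borel_measurable_continuous_on_indicator[OF _ controlled_path_continuous[OF assms]]
    by (simp add: set_borel_measurable_def)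
qed

lemma net_benefit_measurable:
  assumes "controlled_path x u X"
  shows "set_borel_measurable lborel {0..} (\<lambda>t. exp (- \<rho> * t) * (ln (u t) - k * (X t)\<^sup>2))"
proof -
  have [measurable]: "(\<lambda>t. indicat_real {0..} t * u t) \<in> borel_measurable borel"
    "(\<lambda>t. indicat_real {0..} t * X t) \<in> borel_measurable borel"
    using controlled_path_measurable[OF assms] by (auto simp: set_borel_measurable_def)
  have "(\<lambda>t. indicat_real {0..} t * (exp (- \<rho> * t) *
      (ln (indicat_real {0..} t * u t) - k * (indicat_real {0..} t * X t)\<^sup>2))) \<in> borel_measurable borel"
    by measurable
  also have "(\<lambda>t. indicat_real {0..} t * (exp (- \<rho> * t) *
      (ln (indicat_real {0..} t * u t) - k * (indicat_real {0..} t * X t)\<^sup>2)))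
      = (\<lambda>t. indicat_real {0..} t * (exp (- \<rho> * t) * (ln (u t) - k * (X t)\<^sup>2)))"
    by (auto simp: indicator_def)
  finally show ?thesis by (simp add: set_borel_measurable_def)
qed

lemma reward_measurable:
  "controlled_path x u X \<Longrightarrow> set_borel_measurable lborel {0..} (reward u X)"
  using net_benefit_measurable[of x u X c] by (simp add: reward_def[abs_def])

subsection \<open>An a priori bound\<close>

text \<open>
  Formally \<open>p = 1/(1+X)\<close> satisfies \<open>- p' = (u - b X + r X) p\<^sup>2 \<ge> u p\<^sup>2 - b\<close>, and \<open>0 \<le> p \<le> 1\<close>.
  As \<open>X\<close> is only absolutely continuous, this is carried out on short intervals, where
  \<open>p s - p t = p s p t (X t - X s)\<close> holds exactly and \<open>p\<close> hardly changes.
\<close>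

lemma weighted_control_integral_le:
  assumes sol: "solves T x u X" and u: "\<And>t. 0 \<le> t \<Longrightarrow> t \<le> T \<Longrightarrow> 0 \<le> u t" and T: "0 \<le> T"
  shows "(LINT t:{0..T}|lborel. u t * (1 / (1 + X t))\<^sup>2) \<le> 1 + b * T"
proof -
  define p where "p t = 1 / (1 + X t)" for t
  have X0: "0 \<le> X t" if "0 \<le> t" "t \<le> T" for t using solvesD(3)[OF sol] that by auto
  have p: "0 \<le> p t" "p t \<le> 1" "p t * X t \<le> 1" if "0 \<le> t" "t \<le> T" for t
    using X0[OF that] by (auto simp: p_def divide_simps)
  have p_diff: "\<bar>p s - p t\<bar> \<le> \<bar>X s - X t\<bar>" if "0 \<le> s" "s \<le> T" "0 \<le> t" "t \<le> T" for s t
  proof -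
    have "p s - p t = (p s * p t) * (X t - X s)"
      using X0[of s] X0[of t] that by (simp add: p_def field_simps)
    moreover have "p s * p t \<le> 1" "0 \<le> p s * p t" using p[of s] p[of t] that by (auto intro: mult_le_one)
    ultimately show ?thesis
      by (simp add: abs_mult mult_left_le_one_le abs_minus_commute)
  qed
  have contp: "continuous_on {0..T} p"
    unfolding p_def[abs_def] using X0 solvesD(2)[OF sol] by (intro continuous_intros) (auto simp: add_nonneg_eq_0_iff)
  have int: "set_integrable lborel {0..T} (\<lambda>t. u t * (p t)\<^sup>2)"
    using solvesD(1)[OF sol] contp by (intro set_integrable_mult_continuous continuous_intros)
  define F where "F t = (LINT v:{0..t}|lborel. u v * (p v)\<^sup>2)" for t
  define D where "D t = F t + p t - b * t" for t
  define K where "K t = 2 * (LINT v:{0..t}|lborel. u v) + b * t" for t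
  have "D T \<le> D 0"
  proof (rule increment_bound_local_to_global[where K = K, OF T])
    fix e :: real assume e: "e > 0"
    \<comment> \<open>On intervals of length at most d/2 the state, and with it p, changes by at most e.\<close>
    have "uniformly_continuous_on {0..T} X"
      using solvesD(2)[OF sol] by (intro compact_uniformly_continuous) auto
    then obtain d where d: "d > 0"
      and osc: "\<And>s t. s \<in> {0..T} \<Longrightarrow> t \<in> {0..T} \<Longrightarrow> \<bar>s - t\<bar> < d \<Longrightarrow> \<bar>X s - X t\<bar> < e"
      using e unfolding uniformly_continuous_on_def dist_real_def by (metis abs_minus_commute)
    have "D t - D s \<le> e * (K t - K s)" if st: "0 \<le> s" "s \<le> t" "t \<le> T" "t - s \<le> d / 2" for s t
    proof -
      note sub = set_integrable_Icc_sub[OF _ \<open>0 \<le> s\<close> \<open>t \<le> T\<close>]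
      have close: "\<bar>X v - X s\<bar> \<le> e" "\<bar>X v - X t\<bar> \<le> e" if "v \<in> {s..t}" for v
        using osc[of v s] osc[of v t] that st d by auto
      define U where "U = (LINT v:{s..t}|lborel. u v)"
      have U: "U \<le> X t - X s + (t - s) * (b * (X t + e))"
      proof -
        have "(LINT v:{s..t}|lborel. b * X v - r (X v)) \<le> (LINT v:{s..t}|lborel. b * (X t + e))"
        proof (rule set_integral_mono)
          show "set_integrable lborel {s..t} (\<lambda>v. b * X v - r (X v))"
            using solvesD(2)[OF sol] X0
            by (intro sub borel_integrable_atLeastAtMost' continuous_intros r_continuous_on_compose) auto
          fix v assume v: "v \<in> {s..t}"
          then have "0 \<le> r (X v)" using X0 st by (intro r_nonneg) auto
          moreover have "b * X v \<le> b * (X t + e)" using close(2)[OF v] b_pos by (intro mult_left_mono) auto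
          ultimately show "b * X v - r (X v) \<le> b * (X t + e)" by simp
        qed (rule set_integrable_Icc_const)
        also have "\<dots> = (t - s) * (b * (X t + e))" by (rule set_integral_Icc_const[OF st(2)])
        finally show ?thesis
          unfolding U_def control_integral[OF sol st(1-3)] by simp
      qed
      have pq: "0 \<le> p s * p t" "p s * p t \<le> 1" using p[of s] p[of t] st by (auto intro: mult_le_one)
      \<comment> \<open>Replace the square of p by the product of its end point values, for which the increment is exact.\<close>
      have "F t - F s = (LINT v:{s..t}|lborel. u v * (p v)\<^sup>2)"
        using set_integral_Icc_combine[OF set_integrable_Icc_sub[OF int], of 0 t s] st by (simp add: F_def)
      also have "\<dots> \<le> (LINT v:{s..t}|lborel. (p s * p t + 2 * e) * u v)"
      proof (rule set_integral_mono)
        fix v assume v: "v \<in> {s..t}"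
        have "\<bar>p v - p s\<bar> \<le> e" "\<bar>p v - p t\<bar> \<le> e"
          using close[OF v] p_diff[of v s] p_diff[of v t] v st by fastforce+
        then have diffs: "p v - p s \<le> e" "p v - p t \<le> e" by auto
        have "p v * (p v - p s) \<le> p v * e" "p s * (p v - p t) \<le> p s * e"
          using diffs p(1)[of v] p(1)[of s] v st by (auto intro!: mult_left_mono)
        moreover have "p v * e \<le> 1 * e" "p s * e \<le> 1 * e"
          using p(2)[of v] p(2)[of s] v st e by (auto intro!: mult_right_mono)
        ultimately have "(p v)\<^sup>2 \<le> p s * p t + 2 * e" by (simp add: power2_eq_square algebra_simps)
        then show "u v * (p v)\<^sup>2 \<le> (p s * p t + 2 * e) * u v"
          using u[of v] v st by (subst mult.commute) (auto intro: mult_right_mono)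
      qed (use int solvesD(1)[OF sol] in \<open>auto intro!: sub\<close>)
      also have "\<dots> = (p s * p t + 2 * e) * U" by (simp only: set_integral_mult_right U_def)
      also have "\<dots> = p s * p t * U + 2 * e * U" by (simp add: algebra_simps)
      also have "p s * p t * U \<le> p s * p t * (X t - X s + (t - s) * (b * (X t + e)))"
        using U pq by (intro mult_left_mono)
      also have "\<dots> = p s - p t + b * (t - s) * (p s * (p t * X t) + p s * p t * e)"
      proof -
        have "p s * p t * (X t - X s) = p s - p t"
          using X0[of s] X0[of t] st by (simp add: p_def field_simps)
        then show ?thesis by (simp add: algebra_simps)
      qed
      also have "\<dots> \<le> p s - p t + b * (t - s) * (1 + 1 * e)"
      proof -
        have "p s * (p t * X t) \<le> 1" using p[of s] p[of t] X0[of t] st by (intro mult_le_one[where b = "p t * X t"]) auto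
        moreover have "p s * p t * e \<le> 1 * e" using pq e by (intro mult_right_mono) auto
        ultimately show ?thesis using st b_pos by (intro add_left_mono mult_left_mono) auto
      qed
      finally have "F t - F s \<le> p s - p t + b * (t - s) * (1 + e) + 2 * e * U" by simp
      moreover have "K t - K s = 2 * U + b * (t - s)"
        using set_integral_Icc_combine[OF set_integrable_Icc_sub[OF solvesD(1)[OF sol]], of 0 t s] st
        by (simp add: K_def U_def algebra_simps)
      then have "e * (K t - K s) = e * (2 * U + b * (t - s))" by simp
      ultimately show ?thesis by (simp add: D_def algebra_simps)
    qed
    then show "\<exists>d>0. \<forall>s t. 0 \<le> s \<longrightarrow> s \<le> t \<longrightarrow> t \<le> T \<longrightarrow> t - s \<le> d \<longrightarrow> D t - D s \<le> e * (K t - K s)"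
      using d by (intro exI[of _ "d / 2"]) auto
  qed
  moreover have "F 0 = 0"
    using set_borel_integral_eq_integral(2)[of "{0..0}" "\<lambda>v. u v * (p v)\<^sup>2"] set_integrable_Icc_sub[OF int, of 0 0] T
    by (simp add: F_def)
  ultimately have "F T \<le> 1 + b * T" using p(2)[of 0] p(1)[of T] T by (simp add: D_def)
  then show ?thesis by (simp add: F_def p_def)
qed

text \<open>
  The a priori bound: with \<open>2 ln (1 + x) \<le> 2 x \<le> k x\<^sup>2 + 1/k\<close>, the inequality \<open>ln y \<le> y - 1\<close> at
  \<open>y = u/(1+X)\<^sup>2\<close> bounds \<open>ln u - k X\<^sup>2\<close> by \<open>u/(1+X)\<^sup>2 + 1/k\<close>. The bound is uniform in the path and
  in the initial state, and any \<open>k > 0\<close> may be used, which leaves part of \<open>c X\<^sup>2\<close> to spare.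
\<close>

lemma net_benefit_positive_part:
  assumes path: "controlled_path x u X" and k: "k > 0"
  shows "set_integrable lborel {0..} (\<lambda>t. exp (- \<rho> * t) * max 0 (ln (u t) - k * (X t)\<^sup>2))"
    and "(LINT t:{0..}|lborel. exp (- \<rho> * t) * max 0 (ln (u t) - k * (X t)\<^sup>2)) \<le> 1 + (b + 1 / k) / \<rho>"
proof -
  define f where "f t = u t * (1 / (1 + X t))\<^sup>2 + 1 / k" for t
  note sol = controlled_pathD(2)[OF path] and u = controlled_pathD(1)[OF path] and X = controlled_pathD(3)[OF path]
  have int_w: "set_integrable lborel {0..T} (\<lambda>t. u t * (1 / (1 + X t))\<^sup>2)" if "0 \<le> T" for T
    using solvesD[OF sol[OF that]]
    by (intro set_integrable_mult_continuous continuous_intros) (auto simp: add_nonneg_eq_0_iff)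
  have int_f: "set_integrable lborel {0..T} f" if "0 \<le> T" for T
    unfolding f_def[abs_def] using int_w[OF that] set_integrable_Icc_const by (rule set_integral_add(1))
  have bound: "(LINT t:{0..T}|lborel. f t) \<le> 1 + (b + 1 / k) * T" if "0 \<le> T" for T
  proof -
    have "(LINT t:{0..T}|lborel. f t) = (LINT t:{0..T}|lborel. u t * (1 / (1 + X t))\<^sup>2) + (LINT t:{0..T}|lborel. 1 / k)"
      unfolding f_def[abs_def] using int_w[OF that] set_integrable_Icc_const by (rule set_integral_add(2))
    also have "\<dots> \<le> 1 + b * T + T * (1 / k)"
      using weighted_control_integral_le[OF sol[OF that]] u that
      by (simp add: set_integral_Icc_const less_imp_le)
    finally show ?thesis by (simp add: algebra_simps)
  qed
  have f0: "0 \<le> f t" if "0 \<le> t" for t using u[OF that] k by (simp add: f_def)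
  have disc: "set_integrable lborel {0..} (\<lambda>t. exp (- \<rho> * t) * f t)"
    "(LINT t:{0..}|lborel. exp (- \<rho> * t) * f t) \<le> 1 + (b + 1 / k) / \<rho>"
    using discounted_integral_bound[of \<rho> f 1 "b + 1 / k"] \<rho>_pos b_pos k f0 int_f bound
      set_borel_measurable_half_line[OF int_f] by auto
  have le: "max 0 (ln (u t) - k * (X t)\<^sup>2) \<le> f t" if "0 \<le> t" for t
  proof -
    have X1: "0 < 1 + X t" using X[OF that] by simp
    have "ln (u t * (1 / (1 + X t))\<^sup>2) \<le> u t * (1 / (1 + X t))\<^sup>2 - 1"
      using u[OF that] X1 by (intro ln_le_minus_one) auto
    moreover have "ln (u t * (1 / (1 + X t))\<^sup>2) = ln (u t) - 2 * ln (1 + X t)"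
      using u[OF that] X1 by (simp add: ln_mult ln_div ln_realpow power_divide)
    moreover have "ln (1 + X t) \<le> X t" using X[OF that] by (rule ln_add_one_self_le_self)
    moreover have "2 * X t \<le> k * (X t)\<^sup>2 + 1 / k"
    proof -
      have "0 \<le> k * (X t - 1 / k)\<^sup>2" using k by simp
      also have "\<dots> = k * (X t)\<^sup>2 + 1 / k - 2 * X t" using k by (simp add: power2_eq_square field_simps)
      finally show ?thesis by simp
    qed
    ultimately show ?thesis using f0[OF that] by (simp add: f_def)
  qed
  have meas: "set_borel_measurable lborel {0..} (\<lambda>t. exp (- \<rho> * t) * max 0 (ln (u t) - k * (X t)\<^sup>2))"
  proof -
    have "(\<lambda>t. max 0 (indicat_real {0..} t * (exp (- \<rho> * t) * (ln (u t) - k * (X t)\<^sup>2)))) \<in> borel_measurable borel"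
      using net_benefit_measurable[OF path, of k] by (auto simp: set_borel_measurable_def)
    moreover have "max 0 (indicat_real {0..} t * (exp (- \<rho> * t) * y)) = indicat_real {0..} t * (exp (- \<rho> * t) * max 0 y)" for t y
      by (auto simp: indicator_def max_def mult_le_0_iff zero_le_mult_iff)
    ultimately show ?thesis by (simp add: set_borel_measurable_def)
  qed
  show int: "set_integrable lborel {0..} (\<lambda>t. exp (- \<rho> * t) * max 0 (ln (u t) - k * (X t)\<^sup>2))"
    using f0 le by (intro set_integrable_bound[OF disc(1) meas]) (auto simp: abs_mult)
  have "(LINT t:{0..}|lborel. exp (- \<rho> * t) * max 0 (ln (u t) - k * (X t)\<^sup>2)) \<le> (LINT t:{0..}|lborel. exp (- \<rho> * t) * f t)"
    using le by (intro set_integral_mono[OF int disc(1)]) auto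
  with disc(2) show "(LINT t:{0..}|lborel. exp (- \<rho> * t) * max 0 (ln (u t) - k * (X t)\<^sup>2)) \<le> 1 + (b + 1 / k) / \<rho>"
    by simp
qed

lemma reward_le_positive_part: "reward u X t \<le> exp (- \<rho> * t) * max 0 (ln (u t) - c * (X t)\<^sup>2)"
  by (simp add: reward_def)

lemma regular_pathI:
  assumes path: "controlled_path x u X" and g: "set_integrable lborel {0..} g"
    and le: "\<And>t. 0 \<le> t \<Longrightarrow> g t \<le> reward u X t"
  shows "regular_path x u X"
proof -
  have "set_integrable lborel {0..} (\<lambda>t. \<bar>g t\<bar> + exp (- \<rho> * t) * max 0 (ln (u t) - c * (X t)\<^sup>2))"
    using net_benefit_positive_part(1)[OF path c_pos] g by (intro set_integral_add(1) set_integrable_abs)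
  moreover have bnd: "\<bar>reward u X t\<bar> \<le> \<bar>g t\<bar> + exp (- \<rho> * t) * max 0 (ln (u t) - c * (X t)\<^sup>2)" if "0 \<le> t" for t
  proof -
    have "0 \<le> exp (- \<rho> * t) * max 0 (ln (u t) - c * (X t)\<^sup>2)" by simp
    then show ?thesis
      using le[OF that] reward_le_positive_part[of u X t] by linarith
  qed
  ultimately have "set_integrable lborel {0..} (reward u X)"
    by (intro set_integrable_bound[OF _ reward_measurable[OF path]])
      (auto intro: order.trans[OF bnd abs_ge_self])
  then show ?thesis using path by (simp add: regular_path_def)
qed

definition payoff_bound :: "real \<Rightarrow> real" where
  "payoff_bound k = 1 + (b + 1 / k) / \<rho>"

lemma regular_pathD:
  assumes "regular_path x u X"
  shows "controlled_path x u X" "set_integrable lborel {0..} (reward u X)"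
  using assms by (auto simp: regular_path_def)

lemma payoff_le_bound:
  assumes "regular_path x u X"
  shows "payoff u X \<le> payoff_bound c"
proof -
  note p = regular_pathD[OF assms]
  have "payoff u X \<le> (LINT t:{0..}|lborel. exp (- \<rho> * t) * max 0 (ln (u t) - c * (X t)\<^sup>2))"
    unfolding payoff_def
    using net_benefit_positive_part(1)[OF p(1) c_pos] p(2) reward_le_positive_part by (intro set_integral_mono) auto
  also have "\<dots> \<le> payoff_bound c" using net_benefit_positive_part(2)[OF p(1) c_pos] by (simp add: payoff_bound_def)
  finally show ?thesis .
qed

text \<open>
  The part \<open>c/2 X\<^sup>2\<close> of the cost is the difference of \<open>ln u - c/2 X\<^sup>2\<close>, which is bounded above in
  the mean, and the net benefit.
\<close>

lemma square_integrable_state: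
  assumes "regular_path x u X"
  shows "set_integrable lborel {0..} (\<lambda>t. exp (- \<rho> * t) * (X t)\<^sup>2)"
    and "c / 2 * (LINT t:{0..}|lborel. exp (- \<rho> * t) * (X t)\<^sup>2) \<le> payoff_bound (c / 2) - payoff u X"
proof -
  note p = regular_pathD[OF assms]
  define P where "P t = exp (- \<rho> * t) * max 0 (ln (u t) - c / 2 * (X t)\<^sup>2)" for t
  have P: "set_integrable lborel {0..} P" "(LINT t:{0..}|lborel. P t) \<le> payoff_bound (c / 2)"
    using net_benefit_positive_part[OF p(1), of "c / 2"] c_pos unfolding P_def payoff_bound_def by auto
  have diff: "set_integrable lborel {0..} (\<lambda>t. P t - reward u X t)"
    using P(1) p(2) by (rule set_integral_diff(1))
  have le: "c / 2 * (exp (- \<rho> * t) * (X t)\<^sup>2) \<le> P t - reward u X t" for t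
  proof -
    have "c / 2 * (exp (- \<rho> * t) * (X t)\<^sup>2) = exp (- \<rho> * t) * (ln (u t) - c / 2 * (X t)\<^sup>2) - reward u X t"
      by (simp add: reward_def algebra_simps)
    also have "\<dots> \<le> P t - reward u X t" by (simp add: P_def)
    finally show ?thesis .
  qed
  have "(\<lambda>t. exp (- \<rho> * t) * (indicat_real {0..} t * X t)\<^sup>2) \<in> borel_measurable borel"
    using controlled_path_measurable(2)[OF p(1)] by (auto simp: set_borel_measurable_def)
  moreover have "(\<lambda>t. exp (- \<rho> * t) * (indicat_real {0..} t * X t)\<^sup>2)
      = (\<lambda>t. indicat_real {0..} t * (exp (- \<rho> * t) * (X t)\<^sup>2))"
    by (auto simp: indicator_def)
  ultimately have meas: "set_borel_measurable lborel {0..} (\<lambda>t. exp (- \<rho> * t) * (X t)\<^sup>2)"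
    by (simp add: set_borel_measurable_def)
  have "norm (exp (- \<rho> * t) * (X t)\<^sup>2) \<le> norm (2 / c * (P t - reward u X t))" for t
  proof -
    have "exp (- \<rho> * t) * (X t)\<^sup>2 \<le> 2 / c * (P t - reward u X t)"
      using le[of t] c_pos by (simp add: field_simps)
    moreover have "0 \<le> exp (- \<rho> * t) * (X t)\<^sup>2" by simp
    ultimately show ?thesis unfolding real_norm_def by linarith
  qed
  then show int: "set_integrable lborel {0..} (\<lambda>t. exp (- \<rho> * t) * (X t)\<^sup>2)"
    by (intro set_integrable_bound[OF set_integrable_mult_right[OF diff, of "2 / c"] meas]) auto
  have "(LINT t:{0..}|lborel. c / 2 * (exp (- \<rho> * t) * (X t)\<^sup>2)) \<le> (LINT t:{0..}|lborel. P t - reward u X t)"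
    using int diff le by (intro set_integral_mono) auto
  also have "\<dots> = (LINT t:{0..}|lborel. P t) - payoff u X"
    unfolding payoff_def using P(1) p(2) by (rule set_integral_diff(2))
  finally show "c / 2 * (LINT t:{0..}|lborel. exp (- \<rho> * t) * (X t)\<^sup>2) \<le> payoff_bound (c / 2) - payoff u X"
    using P(2) by simp
qed

text \<open>
  The state relaxes exponentially to \<open>k = (a + 1)/b\<close>. The control is then \<open>a + 1 - r X \<ge> 1\<close>, so
  the reward is bounded below.
\<close>

lemma regular_path_exists:
  assumes "0 \<le> x"
  shows "\<exists>u X. regular_path x u X"
proof -
  define k where "k = (a + 1) / b"
  define Z where "Z t = x * exp (- b * t) + k * (1 - exp (- b * t))" for t
  define z where "z t = (k - x) * b * exp (- b * t)" for t
  define u where "u t = z t + b * Z t - r (Z t)" for t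
  have k: "0 < k" using a_nonneg b_pos by (simp add: k_def)
  have Z0: "0 \<le> Z t" "Z t \<le> x + k" if "0 \<le> t" for t
  proof -
    have e: "exp (- b * t) \<le> 1" using that b_pos by simp
    show "0 \<le> Z t" unfolding Z_def using e k assms by (intro add_nonneg_nonneg mult_nonneg_nonneg) auto
    show "Z t \<le> x + k"
      unfolding Z_def using e k assms by (intro add_mono) (auto simp: mult_left_le)
  qed
  have u_eq: "u t = a + 1 - r (Z t)" for t
    using b_pos by (simp add: u_def z_def Z_def k_def field_simps)
  have u: "1 \<le> u t" if "0 \<le> t" for t using r_le[OF Z0(1)[OF that]] by (simp add: u_eq)
  have "solves T (Z 0) u Z" if "0 \<le> T" for T
    unfolding u_def[abs_def]
  proof (rule solves_curve[OF that])
    show "(Z has_real_derivative z t) (at t)" for t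
      unfolding Z_def[abs_def] z_def by (auto intro!: derivative_eq_intros simp: algebra_simps)
    show "continuous_on UNIV z" unfolding z_def[abs_def] by (intro continuous_intros)
  qed (rule Z0)
  then have path: "controlled_path x u Z"
    using u by (force simp: controlled_path_def Z_def)
  have "regular_path x u Z"
  proof (rule regular_pathI[OF path])
    show "set_integrable lborel {0..} (\<lambda>t. exp (- \<rho> * t) * (- c * (x + k)\<^sup>2))"
      by (rule discount_integrable[OF \<rho>_pos])
    fix t :: real assume t: "0 \<le> t"
    have "c * (Z t)\<^sup>2 \<le> c * (x + k)\<^sup>2" using Z0[OF t] c_pos by (intro mult_left_mono power_mono) auto
    then show "exp (- \<rho> * t) * (- c * (x + k)\<^sup>2) \<le> reward u Z t"
      unfolding reward_def using ln_ge_zero[OF u[OF t]] by (intro mult_left_mono) auto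
  qed
  then show ?thesis by blast
qed

lemma payoff_le_V: "regular_path x u X \<Longrightarrow> payoff u X \<le> V x"
  unfolding V_def using payoff_le_bound by (intro cSup_upper bdd_aboveI[of _ "payoff_bound c"]) auto

lemma V_least:
  assumes "0 \<le> x" "\<And>u X. regular_path x u X \<Longrightarrow> payoff u X \<le> B"
  shows "V x \<le> B"
  unfolding V_def using assms regular_path_exists[OF assms(1)] by (intro cSup_least) auto

lemma nearly_optimal_path:
  assumes "0 \<le> x" "0 < e"
  obtains u X where "regular_path x u X" "V x - e < payoff u X"
proof -
  have "\<exists>u X. regular_path x u X \<and> V x - e < payoff u X"
  proof (rule ccontr)
    assume "\<not> ?thesis"
    then have "V x \<le> V x - e" by (intro V_least[OF assms(1)]) (auto simp: not_less)
    with assms(2) show False by simp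
  qed
  with that show ?thesis by blast
qed

subsection \<open>Dynamic programming\<close>

lemma reward_shift: "reward u X (T + s) = exp (- \<rho> * T) * reward (\<lambda>t. u (T + t)) (\<lambda>t. X (T + t)) s"
proof -
  have "exp (- \<rho> * (T + s)) = exp (- \<rho> * T) * exp (- \<rho> * s)"
    by (simp add: exp_add[symmetric] algebra_simps)
  then show ?thesis by (simp add: reward_def)
qed

lemma half_line_shift: "{T..} = (+) T ` {0::real..}"
  by (simp add: image_add_atLeast)

text \<open>
  One half of the dynamic programming principle: the tail of a path is a path from the state
  reached.
\<close>

lemma payoff_split:
  assumes "regular_path x u X" "0 \<le> T"
  shows "payoff u X \<le> (LINT t:{0..T}|lborel. reward u X t) + exp (- \<rho> * T) * V (X T)"
proof -
  note p = regular_pathD[OF assms(1)]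
  let ?u = "\<lambda>t. u (T + t)" and ?X = "\<lambda>t. X (T + t)"
  have "controlled_path (X T) ?u ?X"
    unfolding controlled_path_def
    using solves_shift[of T _ x u X] controlled_pathD[OF p(1)] assms(2) by auto
  moreover have "set_integrable lborel {T..} (reward u X)"
    using p(2) assms(2) by (auto intro: set_integrable_subset)
  then have "set_integrable lborel {0..} (\<lambda>s. exp (- \<rho> * T) * reward ?u ?X s)"
    unfolding half_line_shift[of T] set_integrable_shift reward_shift .
  then have "set_integrable lborel {0..} (reward ?u ?X)"
    by simp
  ultimately have "payoff ?u ?X \<le> V (X T)"
    by (intro payoff_le_V) (simp add: regular_path_def)
  moreover have "(LINT t:{T..}|lborel. reward u X t) = exp (- \<rho> * T) * payoff ?u ?X"
    unfolding half_line_shift[of T] set_integral_shift reward_shift payoff_def by simp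
  ultimately show ?thesis
    unfolding payoff_def using set_integral_half_line_split[OF p(2) assms(2)] by simp
qed

text \<open>
  The other half: an initial segment can be continued by any path from the state that it reaches.
\<close>

lemma V_ge_initial_segment:
  assumes sol: "solves T x u X" and u: "\<And>t. 0 \<le> t \<Longrightarrow> t \<le> T \<Longrightarrow> 0 < u t"
    and int: "set_integrable lborel {0..T} (reward u X)" and T: "0 \<le> T"
  shows "(LINT t:{0..T}|lborel. reward u X t) + exp (- \<rho> * T) * V (X T) \<le> V x"
proof -
  have "V (X T) \<le> exp (\<rho> * T) * (V x - (LINT t:{0..T}|lborel. reward u X t))"
  proof (rule V_least)
    show "0 \<le> X T" using solvesD(3)[OF sol] T by auto
    fix v Y assume reg: "regular_path (X T) v Y"
    note p = regular_pathD[OF reg]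
    let ?w = "glue T u v" and ?Z = "glue T X Y"
    have rew: "reward ?w ?Z = glue T (reward u X) (\<lambda>s. exp (- \<rho> * T) * reward v Y s)"
      by (auto simp: reward_def glue_def fun_eq_iff exp_add[symmetric] algebra_simps)
    have path: "controlled_path x ?w ?Z"
      unfolding controlled_path_def
    proof (intro conjI allI impI)
      fix S :: real assume "0 \<le> S"
      then have "solves (T + S) x ?w ?Z"
        using solves_glue[OF sol controlled_pathD(2)[OF p(1)]] T by simp
      then show "solves S x ?w ?Z" by (rule solves_mono) (use T in simp)
    qed (use u controlled_pathD(1)[OF p(1)] in \<open>auto simp: glue_def\<close>)
    have int_v: "set_integrable lborel {0..} (\<lambda>s. exp (- \<rho> * T) * reward v Y s)"
      using p(2) by simp
    have "{0..T} \<union> (+) T ` {0..} = {0..}" using T by (auto simp: half_line_shift[symmetric])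
    then have "set_integrable lborel {0..} (reward ?w ?Z)"
      unfolding rew using set_integrable_glue[OF int int_v T] by simp
    with path have reg': "regular_path x ?w ?Z" by (simp add: regular_path_def)
    have "payoff ?w ?Z = (LINT t:{0..T}|lborel. reward ?w ?Z t) + (LINT t:{T..}|lborel. reward ?w ?Z t)"
      unfolding payoff_def using regular_pathD(2)[OF reg'] T by (rule set_integral_half_line_split)
    also have "(LINT t:{0..T}|lborel. reward ?w ?Z t) = (LINT t:{0..T}|lborel. reward u X t)"
      unfolding rew by (intro set_lebesgue_integral_cong) (auto simp: glue_def)
    also have "(LINT t:{T..}|lborel. reward ?w ?Z t) = (LINT s:{0..}|lborel. exp (- \<rho> * T) * reward v Y s)"
      unfolding rew half_line_shift[of T] set_integral_shift using int_v by (rule set_integral_glue_tail) simp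
    also have "\<dots> = exp (- \<rho> * T) * payoff v Y" by (simp add: payoff_def)
    finally have "exp (- \<rho> * T) * payoff v Y \<le> V x - (LINT t:{0..T}|lborel. reward u X t)"
      using payoff_le_V[OF reg'] by simp
    then have "exp (\<rho> * T) * (exp (- \<rho> * T) * payoff v Y) \<le> exp (\<rho> * T) * (V x - (LINT t:{0..T}|lborel. reward u X t))"
      by (intro mult_left_mono) auto
    then show "payoff v Y \<le> exp (\<rho> * T) * (V x - (LINT t:{0..T}|lborel. reward u X t))"
      by (simp add: mult.assoc[symmetric] exp_add[symmetric])
  qed
  then have "exp (- \<rho> * T) * V (X T) \<le> exp (- \<rho> * T) * (exp (\<rho> * T) * (V x - (LINT t:{0..T}|lborel. reward u X t)))"
    by (intro mult_left_mono) auto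
  then show ?thesis by (simp add: mult.assoc[symmetric] exp_add[symmetric])
qed

section \<open>Monotonicity and continuity of the value function\<close>

lemma reward_continuous:
  assumes "continuous_on S u" "continuous_on S X" "\<And>t. t \<in> S \<Longrightarrow> 0 < u t"
  shows "continuous_on S (reward u X)"
  unfolding reward_def[abs_def]
  by (intro continuous_intros assms(1,2)) (use assms(3) in force)

lemma V_ge_along_curve:
  fixes Z z :: "real \<Rightarrow> real"
  defines "u \<equiv> \<lambda>t. z t + b * Z t - r (Z t)"
  assumes T: "0 \<le> T" and Z: "\<And>t. (Z has_real_derivative z t) (at t)" and z: "continuous_on UNIV z"
    and nonneg: "\<And>t. 0 \<le> t \<Longrightarrow> t \<le> T \<Longrightarrow> 0 \<le> Z t"
    and u: "\<And>t. 0 \<le> t \<Longrightarrow> t \<le> T \<Longrightarrow> 0 < u t"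
    and m: "\<And>t. 0 \<le> t \<Longrightarrow> t \<le> T \<Longrightarrow> m \<le> reward u Z t"
  shows "T * m + exp (- \<rho> * T) * V (Z T) \<le> V (Z 0)"
proof -
  have sol: "solves T (Z 0) u Z"
    unfolding u_def using T Z z nonneg by (rule solves_curve)
  have cZ: "continuous_on {0..T} Z"
    by (meson DERIV_continuous_on Z has_field_derivative_at_within)
  have "continuous_on {0..T} u"
    unfolding u_def using nonneg cZ
    by (intro continuous_intros r_continuous_on_compose continuous_on_subset[OF z]) auto
  then have int: "set_integrable lborel {0..T} (reward u Z)"
    using cZ u by (intro borel_integrable_atLeastAtMost' reward_continuous) auto
  have "T * m = (LINT t:{0..T}|lborel. m)" using set_integral_Icc_const[OF T, of m] by simp
  also have "\<dots> \<le> (LINT t:{0..T}|lborel. reward u Z t)"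
    using m by (intro set_integral_mono set_integrable_Icc_const int) auto
  finally show ?thesis using V_ge_initial_segment[OF sol u int T] by simp
qed

text \<open>
  From \<open>x\<close> move to \<open>y > x\<close> with constant speed during a short time \<open>T\<close>. The control is then at
  least \<open>1\<close>, so that only the cost of order \<open>T\<close> is lost.
\<close>

lemma V_antimono:
  assumes "0 \<le> x" "x \<le> y"
  shows "V y \<le> V x"
proof (cases "x = y")
  case False
  with assms have xy: "x < y" by simp
  have bound: "T * - (c * y\<^sup>2) + exp (- \<rho> * T) * V y \<le> V x" if T: "0 < T" "T \<le> (y - x) / (a + 1)" for T
  proof -
    define q where "q = (y - x) / T"
    have q: "a + 1 \<le> q" "q * T = y - x" using T a_nonneg xy by (auto simp: q_def field_simps)
    have Z: "0 \<le> x + q * t" "x + q * t \<le> y" if "0 \<le> t" "t \<le> T" for t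
    proof -
      show "0 \<le> x + q * t" using assms q a_nonneg that by auto
      have "q * t \<le> q * T" using q(1) a_nonneg that by (intro mult_left_mono) auto
      then show "x + q * t \<le> y" using q by simp
    qed
    have u: "1 \<le> q + b * (x + q * t) - r (x + q * t)" if "0 \<le> t" "t \<le> T" for t
      using q(1) r_le[OF Z(1)[OF that]] mult_nonneg_nonneg[OF less_imp_le[OF b_pos] Z(1)[OF that]] by linarith
    have u': "0 < q + b * (x + q * t) - r (x + q * t)" if "0 \<le> t" "t \<le> T" for t
      using u[OF that] by simp
    have "T * - (c * y\<^sup>2) + exp (- \<rho> * T) * V (x + q * T) \<le> V (x + q * 0)"
    proof (rule V_ge_along_curve[where z = "\<lambda>_. q"])
      fix t assume t: "0 \<le> t" "t \<le> T"
      have "c * (x + q * t)\<^sup>2 \<le> c * y\<^sup>2" using Z[OF t] c_pos by (intro mult_left_mono power_mono) auto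
      then have "- (c * y\<^sup>2) \<le> exp (- \<rho> * t) * - (c * y\<^sup>2)"
        using t \<rho>_pos c_pos by (simp add: mult_left_le_one_le)
      also have "\<dots> \<le> reward (\<lambda>t. q + b * (x + q * t) - r (x + q * t)) (\<lambda>t. x + q * t) t"
        unfolding reward_def using ln_ge_zero[OF u[OF t]] \<open>c * (x + q * t)\<^sup>2 \<le> c * y\<^sup>2\<close>
        by (intro mult_left_mono) auto
      finally show "- (c * y\<^sup>2) \<le> reward (\<lambda>t. q + b * (x + q * t) - r (x + q * t)) (\<lambda>t. x + q * t) t" .
    qed (use T Z(1) u' in \<open>auto intro!: derivative_eq_intros\<close>)
    then show ?thesis using q by simp
  qed
  have lim: "((\<lambda>T. T * - (c * y\<^sup>2) + exp (- \<rho> * T) * V y) \<longlongrightarrow> 0 * - (c * y\<^sup>2) + exp (- \<rho> * 0) * V y) (at_right 0)"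
    by (intro tendsto_intros)
  have ev: "\<forall>\<^sub>F T in at_right 0. T * - (c * y\<^sup>2) + exp (- \<rho> * T) * V y \<le> V x"
    using xy a_nonneg bound by (auto simp: eventually_at_right_field intro!: exI[of _ "(y - x) / (a + 1)"])
  show ?thesis using tendsto_upperbound[OF lim ev] by simp
qed simp

text \<open>
  The solution of \<open>Z' = L Z (1 - Z/K)\<close> with \<open>Z 0 = d\<close>. It serves as the distance at which a path
  from \<open>x + d\<close> follows a path from \<open>x\<close>. It grows like \<open>exp (L t)\<close>, as the Lipschitz constant of
  \<open>r\<close> demands, but saturates at \<open>K\<close>, which keeps it square integrable for every discount rate.
\<close>

definition logistic :: "real \<Rightarrow> real \<Rightarrow> real \<Rightarrow> real" where
  "logistic K d t = K / (1 + (K / d - 1) * exp (- L * t))"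

lemma logistic:
  assumes "0 < d" "d < K"
  shows "logistic K d 0 = d" and "0 < logistic K d t" and "logistic K d t \<le> K"
    and "(logistic K d has_real_derivative L * logistic K d t * (1 - logistic K d t / K)) (at t)"
    and "continuous_on UNIV (\<lambda>t. L * logistic K d t * (1 - logistic K d t / K))"
proof -
  have A: "0 < K / d - 1" using assms by simp
  have den: "0 < (K / d - 1) * exp (- L * t)" for t using A by simp
  have den': "1 + (K / d - 1) * exp (- L * t) \<noteq> 0" for t using den[of t] by linarith
  show "logistic K d 0 = d" using assms by (simp add: logistic_def)
  show "0 < logistic K d t" 
    unfolding logistic_def using assms den[of t] by (intro divide_pos_pos add_pos_pos) auto
  show "logistic K d t \<le> K"
    using assms den[of t] unfolding logistic_def by (simp add: divide_le_eq pos_divide_le_eq mult_le_cancel_left1 add_pos_pos)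
  define s where "s = (K / d - 1) * exp (- L * t)"
  have "(logistic K d has_real_derivative - (K * (- L * s)) / (1 + s)\<^sup>2) (at t)"
    unfolding logistic_def[abs_def] s_def using den'[of t]
    by (auto intro!: derivative_eq_intros simp: power2_eq_square)
  moreover have "- (K * (- L * s)) / (1 + s)\<^sup>2 = L * (K / (1 + s)) * (1 - K / (1 + s) / K)"
    using den'[of t] assms by (simp add: s_def[symmetric] divide_simps power2_eq_square)
  ultimately show "(logistic K d has_real_derivative L * logistic K d t * (1 - logistic K d t / K)) (at t)"
    by (simp add: logistic_def s_def)
  have "continuous_on UNIV (logistic K d)"
    unfolding logistic_def[abs_def] using den' by (intro continuous_intros) auto
  then show "continuous_on UNIV (\<lambda>t. L * logistic K d t * (1 - logistic K d t / K))"
    using assms by (intro continuous_intros) auto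
qed

text \<open>
  The level \<open>K\<close> at which the distance \<open>Z\<close> saturates. By the first summand, \<open>b Z \<ge> a\<close> as soon as
  \<open>L Z \<ge> b K\<close>; the second one leaves room for initial distances up to \<open>1\<close>.
\<close>

definition tracking_bound :: real where
  "tracking_bound = a * L / b\<^sup>2 + 2"

text \<open>
  An exponent \<open>h \<le> 1\<close> with \<open>2 h L \<le> \<rho>/2\<close>: interpolating the growth of the distance with
  exponent \<open>h\<close> costs only half of the discount rate.
\<close>

definition tracking_exponent :: real where
  "tracking_exponent = min 1 (\<rho> / (4 * L))"

definition tracking_error :: "real \<Rightarrow> real" where
  "tracking_error d = tracking_bound\<^sup>2 * (tracking_bound / d - 1) powr (- 2 * tracking_exponent)"

lemma tracking_bound_ge: "2 \<le> tracking_bound"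
  using a_nonneg L_pos by (simp add: tracking_bound_def)

text \<open>
  The control along the displaced path is at least the original one. As long as
  \<open>L Z \<le> b K\<close>, the Lipschitz bound suffices; later the decay term alone makes up for the
  largest possible gain \<open>a\<close> in recycling.
\<close>

lemma logistic_dominates_drift:
  assumes "0 < d" "d \<le> 1" "0 \<le> x"
  defines "Z \<equiv> logistic tracking_bound d"
  shows "r (x + Z t) - r x \<le> L * Z t * (1 - Z t / tracking_bound) + b * Z t"
proof -
  let ?K = tracking_bound
  have K: "0 < ?K" "d < ?K" using tracking_bound_ge assms(2) by auto
  note Z = logistic(2,3)[OF assms(1) K(2), of t, folded Z_def]
  show ?thesis
  proof (cases "L * Z t \<le> b * ?K")
    case True
    have "r (x + Z t) - r x \<le> L * Z t"
      using r_increment[of "x + Z t" x] assms Z by auto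
    moreover have "L * Z t * (Z t / ?K) \<le> b * Z t"
      using True Z K mult_right_mono[OF True, of "Z t"] by (simp add: field_simps)
    ultimately show ?thesis by (simp add: algebra_simps)
  next
    case False
    have "a * L \<le> b\<^sup>2 * ?K" using b_pos by (simp add: tracking_bound_def field_simps)
    also have "\<dots> \<le> b * (L * Z t)" using False b_pos by (simp add: power2_eq_square)
    finally have "a \<le> b * Z t" using L_pos by (simp add: mult.left_commute mult.commute[of a])
    moreover have "r (x + Z t) - r x \<le> a"
      using r_le[of "x + Z t"] r_nonneg[of x] assms Z by auto
    moreover have "0 \<le> L * Z t * (1 - Z t / ?K)" using Z K L_pos by simp
    ultimately show ?thesis by simp
  qed
qed

text \<open>
  With \<open>s = (K/d - 1) exp (- L t)\<close> the distance is \<open>K/(1+s)\<close>, and \<open>1 + s \<ge> s powr h\<close> for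
  \<open>0 < h \<le> 1\<close>. This yields a bound that tends to \<open>0\<close> with \<open>d\<close> and is integrable against the
  discount factor.
\<close>

lemma logistic_square_le:
  assumes "0 < d" "d \<le> 1" "0 \<le> t"
  shows "exp (- \<rho> * t) * (logistic tracking_bound d t)\<^sup>2 \<le> exp (- (\<rho> / 2) * t) * tracking_error d"
proof -
  let ?K = tracking_bound and ?h = tracking_exponent
  define A where "A = ?K / d - 1"
  define s where "s = A * exp (- L * t)"
  have "d < ?K" using tracking_bound_ge assms by simp
  then have A: "0 < A" using assms by (simp add: A_def)
  then have s: "0 < s" by (simp add: s_def)
  have h: "0 < ?h" "?h \<le> 1" "4 * L * ?h \<le> \<rho>"
    using \<rho>_pos L_pos by (auto simp: tracking_exponent_def min_def field_simps)
  have "s powr ?h \<le> 1 + s"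
  proof (cases "s \<le> 1")
    case True
    then have "s powr ?h \<le> 1" using s h by (intro powr_le1) auto
    then show ?thesis using s by simp
  next
    case False
    then have "s powr ?h \<le> s powr 1" using h by (intro powr_mono) auto
    then show ?thesis using s by simp
  qed
  then have "?K / (1 + s) \<le> ?K / s powr ?h"
    using s tracking_bound_ge by (intro divide_left_mono) auto
  then have "(?K / (1 + s))\<^sup>2 \<le> (?K / s powr ?h)\<^sup>2"
    using s tracking_bound_ge by (intro power_mono) auto
  also have "\<dots> = ?K\<^sup>2 * s powr (- 2 * ?h)"
  proof -
    have "(s powr ?h)\<^sup>2 = s powr (2 * ?h)"
      by (simp add: power2_eq_square powr_add[symmetric])
    then show ?thesis by (simp add: power_divide powr_minus divide_inverse power_mult_distrib power_inverse)
  qed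
  also have "s powr (- 2 * ?h) = A powr (- 2 * ?h) * exp (2 * L * ?h * t)"
    using A by (simp add: s_def powr_mult) (simp add: powr_def)
  finally have "(?K / (1 + s))\<^sup>2 \<le> ?K\<^sup>2 * (A powr (- 2 * ?h) * exp (2 * L * ?h * t))" .
  moreover have "logistic ?K d t = ?K / (1 + s)" by (simp add: logistic_def A_def s_def)
  ultimately have "(logistic ?K d t)\<^sup>2 \<le> tracking_error d * exp (2 * L * ?h * t)"
    by (simp add: tracking_error_def A_def mult.assoc)
  then have "exp (- \<rho> * t) * (logistic ?K d t)\<^sup>2 \<le> exp (- \<rho> * t) * (tracking_error d * exp (2 * L * ?h * t))"
    by (intro mult_left_mono) auto
  also have "\<dots> = exp (- \<rho> * t + 2 * L * ?h * t) * tracking_error d" by (subst exp_add) (simp only: ac_simps)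
  also have "\<dots> \<le> exp (- (\<rho> / 2) * t) * tracking_error d"
  proof (rule mult_right_mono)
    have "(2 * L * ?h) * t \<le> (\<rho> / 2) * t" using h assms by (intro mult_right_mono) auto
    then show "exp (- \<rho> * t + 2 * L * ?h * t) \<le> exp (- (\<rho> / 2) * t)" by simp
  qed (simp add: tracking_error_def)
  finally show ?thesis .
qed

text \<open>
  Following a path at distance \<open>Z\<close> changes the cost by \<open>2 X Z + Z\<^sup>2\<close>, which is split into
  \<open>e X\<^sup>2\<close>, controlled by the a priori bound, and \<open>(1 + 1/e) Z\<^sup>2\<close>, controlled by \<open>tracking_error\<close>.
\<close>

lemma payoff_tracking:
  assumes reg: "regular_path x u X" and "x < y" "y - x \<le> 1" and e: "0 < e"
  shows "payoff u X - 2 * e * (payoff_bound (c / 2) - payoff u X)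
           - c * (1 + 1 / e) * (2 / \<rho>) * tracking_error (y - x) \<le> V y"
proof -
  note p = regular_pathD[OF reg]
  define d where "d = y - x"
  define Z where "Z = logistic tracking_bound d"
  define z where "z t = L * Z t * (1 - Z t / tracking_bound)" for t
  define w where "w t = u t + (z t + b * Z t + r (X t) - r (X t + Z t))" for t
  define Y where "Y t = X t + Z t" for t
  have d: "0 < d" "d \<le> 1" "d < tracking_bound" using assms tracking_bound_ge by (auto simp: d_def)
  note log = logistic[OF d(1,3), folded Z_def, folded z_def]
  have X: "0 \<le> X t" if "0 \<le> t" for t using controlled_pathD(3)[OF p(1) that] .
  have w: "u t \<le> w t" if "0 \<le> t" for t
    using logistic_dominates_drift[OF d(1,2) X[OF that], of t] by (simp add: w_def z_def Z_def)
  have u: "0 < u t" if "0 \<le> t" for t using controlled_pathD(1)[OF p(1) that] .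
  have "solves T (x + Z 0) w Y" if "0 \<le> T" for T
    unfolding w_def[abs_def] Y_def[abs_def]
    by (rule solves_perturb[OF controlled_pathD(2)[OF p(1) that] log(4,5)])
       (auto intro!: add_nonneg_nonneg X less_imp_le[OF log(2)])
  moreover have "x + Z 0 = y" using log(1) by (simp add: d_def)
  ultimately have path: "controlled_path y w Y"
    using w u by (force simp: controlled_path_def)
  \<comment> \<open>An integrable minorant of the reward of the displaced path.\<close>
  define g where "g t = reward u X t - c * e * (exp (- \<rho> * t) * (X t)\<^sup>2)
      - c * (1 + 1 / e) * (exp (- (\<rho> / 2) * t) * tracking_error d)" for t
  have sq: "set_integrable lborel {0..} (\<lambda>t. c * e * (exp (- \<rho> * t) * (X t)\<^sup>2))"
    using square_integrable_state(1)[OF reg] by (rule set_integrable_mult_right)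
  have er: "set_integrable lborel {0..} (\<lambda>t. c * (1 + 1 / e) * (exp (- (\<rho> / 2) * t) * tracking_error d))"
    using \<rho>_pos discount_integrable[of "\<rho> / 2" "tracking_error d"] by (intro set_integrable_mult_right) simp
  have g_int: "set_integrable lborel {0..} g"
    unfolding g_def[abs_def] using p(2) sq er by (intro set_integral_diff(1))
  have g_le: "g t \<le> reward w Y t" if t: "0 \<le> t" for t
  proof -
    have "2 * X t * Z t \<le> e * (X t)\<^sup>2 + (Z t)\<^sup>2 / e"
    proof -
      have "0 \<le> e * (X t - Z t / e)\<^sup>2" using e by simp
      also have "\<dots> = e * (X t)\<^sup>2 + (Z t)\<^sup>2 / e - 2 * X t * Z t"
        using e by (simp add: power2_eq_square field_simps)
      finally show ?thesis by simp
    qed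
    then have "(Y t)\<^sup>2 \<le> (X t)\<^sup>2 + e * (X t)\<^sup>2 + (1 + 1 / e) * (Z t)\<^sup>2"
      by (simp add: Y_def power2_sum algebra_simps)
    then have "c * (Y t)\<^sup>2 \<le> c * ((X t)\<^sup>2 + e * (X t)\<^sup>2 + (1 + 1 / e) * (Z t)\<^sup>2)"
      using c_pos by (intro mult_left_mono) auto
    moreover have "ln (u t) \<le> ln (w t)" using w[OF t] u[OF t] by simp
    ultimately have "exp (- \<rho> * t) * (ln (u t) - c * ((X t)\<^sup>2 + e * (X t)\<^sup>2 + (1 + 1 / e) * (Z t)\<^sup>2)) \<le> reward w Y t"
      unfolding reward_def by (intro mult_left_mono) auto
    moreover have "exp (- \<rho> * t) * (ln (u t) - c * ((X t)\<^sup>2 + e * (X t)\<^sup>2 + (1 + 1 / e) * (Z t)\<^sup>2))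
        = reward u X t - c * e * (exp (- \<rho> * t) * (X t)\<^sup>2) - c * (1 + 1 / e) * (exp (- \<rho> * t) * (Z t)\<^sup>2)"
      by (simp add: reward_def algebra_simps)
    moreover have "c * (1 + 1 / e) * (exp (- \<rho> * t) * (Z t)\<^sup>2) \<le> c * (1 + 1 / e) * (exp (- (\<rho> / 2) * t) * tracking_error d)"
      using logistic_square_le[OF d(1,2) t] c_pos e by (intro mult_left_mono) (auto simp: Z_def)
    ultimately show ?thesis by (simp add: g_def)
  qed
  have reg': "regular_path y w Y" using path g_int g_le by (rule regular_pathI)
  have "(LINT t:{0..}|lborel. g t) = payoff u X - c * e * (LINT t:{0..}|lborel. exp (- \<rho> * t) * (X t)\<^sup>2)
      - c * (1 + 1 / e) * (LINT t:{0..}|lborel. exp (- (\<rho> / 2) * t) * tracking_error d)"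
    unfolding g_def[abs_def] payoff_def
    using set_integral_diff(2)[OF set_integral_diff(1)[OF p(2) sq] er] set_integral_diff(2)[OF p(2) sq]
    by (simp only: set_integral_mult_right)
  moreover have "(LINT t:{0..}|lborel. g t) \<le> payoff w Y"
    unfolding payoff_def using g_int regular_pathD(2)[OF reg'] g_le by (intro set_integral_mono) auto
  moreover have "c * e * (LINT t:{0..}|lborel. exp (- \<rho> * t) * (X t)\<^sup>2) \<le> 2 * e * (payoff_bound (c / 2) - payoff u X)"
    using mult_left_mono[OF square_integrable_state(2)[OF reg], of "2 * e"] e by (simp add: algebra_simps)
  moreover have "(LINT t:{0..}|lborel. exp (- (\<rho> / 2) * t) * tracking_error d) \<le> (2 / \<rho>) * tracking_error d"
  proof -
    have "(LINT t:{0..}|lborel. exp (- (\<rho> / 2) * t) * tracking_error d)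
        = tracking_error d * (LINT t:{0..}|lborel. exp (- (\<rho> / 2) * t) * 1)"
      by (simp add: mult.commute)
    also have "\<dots> \<le> tracking_error d * (1 / (\<rho> / 2))"
      using \<rho>_pos discount_integral_le[of "\<rho> / 2" 1] by (intro mult_left_mono) (auto simp: tracking_error_def)
    finally show ?thesis by (simp add: mult.commute)
  qed
  then have "c * (1 + 1 / e) * (LINT t:{0..}|lborel. exp (- (\<rho> / 2) * t) * tracking_error d)
      \<le> c * (1 + 1 / e) * (2 / \<rho>) * tracking_error d"
    using c_pos e unfolding mult.assoc[of "c * (1 + 1 / e)"] by (intro mult_left_mono) auto
  ultimately show ?thesis using payoff_le_V[OF reg'] unfolding d_def by linarith
qed

lemma V_tracking:
  assumes "0 \<le> x" "x < y" "y - x \<le> 1" and e: "0 < e"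
  shows "V x - V y \<le> 2 * e * (payoff_bound (c / 2) - V x) + c * (1 + 1 / e) * (2 / \<rho>) * tracking_error (y - x)"
proof (rule field_le_epsilon)
  fix \<eta> :: real assume \<eta>: "0 < \<eta>"
  obtain u X where reg: "regular_path x u X" and "V x - \<eta> / (1 + 2 * e) < payoff u X"
    using nearly_optimal_path[OF assms(1), of "\<eta> / (1 + 2 * e)"] \<eta> e by auto
  then have "(1 + 2 * e) * (V x - \<eta> / (1 + 2 * e)) \<le> (1 + 2 * e) * payoff u X"
    using e by (intro mult_left_mono) auto
  then have "(1 + 2 * e) * V x - \<eta> \<le> (1 + 2 * e) * payoff u X"
    using e by (simp add: right_diff_distrib)
  then show "V x - V y \<le> 2 * e * (payoff_bound (c / 2) - V x) + c * (1 + 1 / e) * (2 / \<rho>) * tracking_error (y - x) + \<eta>"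
    using payoff_tracking[OF reg assms(2-4)] by (simp add: algebra_simps)
qed

lemma tracking_error_tendsto_0: "(tracking_error \<longlongrightarrow> 0) (at_right 0)"
proof -
  have "0 < tracking_exponent" using \<rho>_pos L_pos by (simp add: tracking_exponent_def)
  moreover have "0 < tracking_bound" using tracking_bound_ge by simp
  ultimately show ?thesis
    unfolding tracking_error_def[abs_def] by real_asymp
qed

lemma V_continuous: "continuous_on {0..} V"
proof (rule continuous_on_half_line)
  fix R :: real assume R: "0 \<le> R"
  show "continuous_on {0..R} V"
    unfolding continuous_on_iff dist_real_def
  proof (intro ballI allI impI)
    fix x \<epsilon> :: real assume x: "x \<in> {0..R}" and \<epsilon>: "0 < \<epsilon>"
    define B where "B = \<bar>payoff_bound (c / 2) - V R\<bar> + 1"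
    define e where "e = \<epsilon> / (4 * B)"
    have B: "0 < B" by (simp add: B_def add_nonneg_pos)
    have e: "0 < e" "2 * e * B = \<epsilon> / 2" using \<epsilon> B by (auto simp: e_def field_simps)
    have "((\<lambda>d. c * (1 + 1 / e) * (2 / \<rho>) * tracking_error d) \<longlongrightarrow> c * (1 + 1 / e) * (2 / \<rho>) * 0) (at_right 0)"
      by (intro tendsto_intros tracking_error_tendsto_0)
    then have "\<forall>\<^sub>F d in at_right 0. c * (1 + 1 / e) * (2 / \<rho>) * tracking_error d < \<epsilon> / 2"
      using \<epsilon> by (intro order_tendstoD(2)) auto
    then obtain d0 where d0: "0 < d0"
      and small: "\<And>d. 0 < d \<Longrightarrow> d < d0 \<Longrightarrow> c * (1 + 1 / e) * (2 / \<rho>) * tracking_error d < \<epsilon> / 2"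
      unfolding eventually_at_right_field by auto
    have close: "\<bar>V s - V t\<bar> < \<epsilon>" if "0 \<le> s" "s < t" "t \<le> R" "t - s < min d0 1" for s t
    proof -
      have "2 * e * (payoff_bound (c / 2) - V s) \<le> 2 * e * B"
        using V_antimono[of s R] that e(1) unfolding B_def by (intro mult_left_mono) auto
      then have "V s - V t < \<epsilon>"
        using V_tracking[of s t e] small[of "t - s"] that e by linarith
      then show ?thesis using V_antimono[of s t] that by simp
    qed
    show "\<exists>d>0. \<forall>x'\<in>{0..R}. \<bar>x' - x\<bar> < d \<longrightarrow> \<bar>V x' - V x\<bar> < \<epsilon>"
    proof (intro exI[of _ "min d0 1"] conjI ballI impI)
      fix x' assume "x' \<in> {0..R}" "\<bar>x' - x\<bar> < min d0 1"
      then show "\<bar>V x' - V x\<bar> < \<epsilon>"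
        using close[of x x'] close[of x' x] x \<epsilon> by (cases x x' rule: linorder_cases) (auto simp: abs_minus_commute)
    qed (use d0 in auto)
  qed
qed

section \<open>Infinitesimal dynamic programming\<close>

lemma discounted_V_expansion:
  assumes x: "0 \<le> x" and \<kappa>: "0 < \<kappa>"
  obtains d where "0 < d" "\<And>T y. 0 \<le> T \<Longrightarrow> T \<le> d \<Longrightarrow> 0 \<le> y \<Longrightarrow> \<bar>y - x\<bar> \<le> d \<Longrightarrow>
    \<bar>exp (- \<rho> * T) * V y - (V y - \<rho> * T * V x)\<bar> \<le> \<kappa> * T"
proof -
  \<comment> \<open>How close V y must be to V x; the remainder of the exponential is of second order in T.\<close>
  define m where "m = min 1 (\<kappa> / (2 * \<rho>))"
  have m: "0 < m" "m \<le> 1" "\<rho> * m \<le> \<kappa> / 2" using \<kappa> \<rho>_pos by (auto simp: m_def min_def field_simps)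
  obtain d1 where d1: "0 < d1" "\<And>y. 0 \<le> y \<Longrightarrow> \<bar>y - x\<bar> < d1 \<Longrightarrow> \<bar>V y - V x\<bar> < m"
    using V_continuous x m(1) unfolding continuous_on_iff dist_real_def by (metis atLeast_iff)
  define B where "B = \<bar>V x\<bar> + 1"
  define d where "d = min (d1 / 2) (\<kappa> / (2 * \<rho>\<^sup>2 * B))"
  have B: "0 < B" by (simp add: B_def add_nonneg_pos)
  have d: "0 < d" "d < d1" "\<rho>\<^sup>2 * d * B \<le> \<kappa> / 2"
    using d1(1) \<kappa> \<rho>_pos B by (auto simp: d_def min_def field_simps)
  show ?thesis
  proof (rule that[OF d(1)])
    fix T y assume T: "0 \<le> T" "T \<le> d" and y: "0 \<le> y" "\<bar>y - x\<bar> \<le> d"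
    have V: "\<bar>V y - V x\<bar> \<le> m" using d1(2)[of y] y d by force
    then have "\<bar>V y\<bar> \<le> B" using m(2) by (simp add: B_def)
    define \<epsilon> where "\<epsilon> = \<rho> * T - (1 - exp (- \<rho> * T))"
    have \<epsilon>: "0 \<le> \<epsilon>" "\<epsilon> \<le> \<rho>\<^sup>2 * T * T"
      using one_minus_exp_bounds[of "\<rho> * T"] T \<rho>_pos by (auto simp: \<epsilon>_def power2_eq_square algebra_simps)
    have "exp (- \<rho> * T) * V y - (V y - \<rho> * T * V x) = \<epsilon> * V y - \<rho> * T * (V y - V x)"
      by (simp add: \<epsilon>_def algebra_simps)
    also have "\<bar>\<dots>\<bar> \<le> \<epsilon> * \<bar>V y\<bar> + \<rho> * T * \<bar>V y - V x\<bar>"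
      using abs_triangle_ineq4[of "\<epsilon> * V y" "\<rho> * T * (V y - V x)"] \<epsilon> T \<rho>_pos by (simp add: abs_mult)
    also have "\<epsilon> * \<bar>V y\<bar> \<le> (\<rho>\<^sup>2 * T * T) * B"
      using \<epsilon> \<open>\<bar>V y\<bar> \<le> B\<close> T by (intro mult_mono) auto
    also have "\<dots> \<le> (\<rho>\<^sup>2 * d * B) * T"
      using T B mult_right_mono[OF T(2), of "\<rho>\<^sup>2 * B * T"] by (simp add: ac_simps)
    also have "\<dots> \<le> \<kappa> / 2 * T" using d T by (intro mult_right_mono) auto
    also have "\<rho> * T * \<bar>V y - V x\<bar> \<le> \<rho> * T * m" using V T \<rho>_pos by (intro mult_left_mono) auto
    also have "\<dots> \<le> \<kappa> / 2 * T" using m(3) T mult_right_mono[OF m(3), of T] by (simp add: ac_simps)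
    finally show "\<bar>exp (- \<rho> * T) * V y - (V y - \<rho> * T * V x)\<bar> \<le> \<kappa> * T" by (simp add: mult.commute)
  qed
qed

text \<open>
  The speed \<open>q\<close> is the one that the control \<open>u0\<close> produces at \<open>x\<close>. Keeping the speed rather than
  the control constant makes the path a straight line; the control stays close to \<open>u0\<close>. At
  \<open>x = 0\<close> the line must not point out of the half-line.
\<close>

lemma V_ge_after_constant_speed:
  assumes x: "0 \<le> x" and u0: "0 < u0" and q: "q = u0 - b * x + r x" and inside: "0 < x \<or> 0 \<le> q"
    and \<kappa>: "0 < \<kappa>"
  obtains d where "0 < d" "\<And>T. 0 \<le> T \<Longrightarrow> T \<le> d \<Longrightarrow>
    0 \<le> x + q * T \<and> V (x + q * T) + T * (ln u0 - c * x\<^sup>2 - \<rho> * V x - \<kappa>) \<le> V x"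
proof -
  define Z where "Z t = x + q * t" for t
  define u where "u t = q + b * Z t - r (Z t)" for t
  have u_0: "u 0 = u0" by (simp add: u_def Z_def q)
  have contZ: "continuous_on S Z" for S unfolding Z_def[abs_def] by (intro continuous_intros)
  obtain T0 where T0: "0 < T0" "\<And>t. 0 \<le> t \<Longrightarrow> t \<le> T0 \<Longrightarrow> 0 \<le> Z t"
  proof (cases "0 \<le> q")
    case True
    then show ?thesis using x that[of 1] by (simp add: Z_def)
  next
    case False
    then have "0 < x" using inside by simp
    show ?thesis
    proof (rule that[of "x / - q"])
      fix t assume "0 \<le> t" "t \<le> x / - q"
      then have "t * - q \<le> x" using False by (subst (asm) pos_le_divide_eq) auto
      then show "0 \<le> Z t" by (simp add: Z_def algebra_simps)
    qed (use \<open>0 < x\<close> False in \<open>simp add: field_simps\<close>)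
  qed
  have "continuous_on {0..T0} u"
    unfolding u_def[abs_def] using T0 by (intro continuous_intros contZ r_continuous_on_compose) auto
  then obtain T1 where T1: "0 < T1" "T1 \<le> T0" "\<And>t. 0 \<le> t \<Longrightarrow> t \<le> T1 \<Longrightarrow> \<bar>u t - u 0\<bar> \<le> u0 / 2"
    using continuous_near_left_end[of T0 u "u0 / 2"] T0(1) u0 by auto
  have u_pos: "0 < u t" if "0 \<le> t" "t \<le> T1" for t
    using T1(3)[OF that] u0 by (simp add: u_0 abs_if split: if_splits)
  have "continuous_on {0..T1} (reward u Z)"
    using u_pos continuous_on_subset[OF \<open>continuous_on {0..T0} u\<close>, of "{0..T1}"] T1(2)
    by (intro reward_continuous contZ) auto
  then obtain T2 where T2: "0 < T2" "T2 \<le> T1" "\<And>t. 0 \<le> t \<Longrightarrow> t \<le> T2 \<Longrightarrow> \<bar>reward u Z t - reward u Z 0\<bar> \<le> \<kappa> / 2"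
    using continuous_near_left_end[of T1 "reward u Z" "\<kappa> / 2"] T1(1) \<kappa> by auto
  have rew_0: "reward u Z 0 = ln u0 - c * x\<^sup>2" by (simp add: reward_def u_0 Z_def)
  obtain d where d: "0 < d" "\<And>T y. 0 \<le> T \<Longrightarrow> T \<le> d \<Longrightarrow> 0 \<le> y \<Longrightarrow> \<bar>y - x\<bar> \<le> d \<Longrightarrow>
      \<bar>exp (- \<rho> * T) * V y - (V y - \<rho> * T * V x)\<bar> \<le> \<kappa> / 2 * T"
    using discounted_V_expansion[OF x, of "\<kappa> / 2"] \<kappa> by auto
  show ?thesis
  proof (rule that[of "min T2 (min d (d / (\<bar>q\<bar> + 1)))"])
    show "0 < min T2 (min d (d / (\<bar>q\<bar> + 1)))" using T2(1) d(1) by simp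
    fix T assume T: "0 \<le> T" "T \<le> min T2 (min d (d / (\<bar>q\<bar> + 1)))"
    then have "T * (\<bar>q\<bar> + 1) \<le> d" by (simp add: pos_le_divide_eq)
    then have near: "\<bar>Z T - x\<bar> \<le> d" using T(1) by (simp add: Z_def abs_mult algebra_simps)
    have Z0: "0 \<le> Z T" using T0(2) T T1 T2 by auto
    have "T * (ln u0 - c * x\<^sup>2 - \<kappa> / 2) + exp (- \<rho> * T) * V (Z T) \<le> V (Z 0)"
    proof (rule V_ge_along_curve[where z = "\<lambda>_. q"])
      show "(Z has_real_derivative q) (at t)" for t
        unfolding Z_def[abs_def] by (auto intro!: derivative_eq_intros)
      fix t assume "0 \<le> t" "t \<le> T"
      then have t: "0 \<le> t" "t \<le> T2" "t \<le> T1" "t \<le> T0" using T T1 T2 by auto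
      show "0 \<le> Z t" using T0(2) t by simp
      show "0 < q + b * Z t - r (Z t)" using u_pos[OF t(1,3)] by (simp add: u_def)
      show "ln u0 - c * x\<^sup>2 - \<kappa> / 2 \<le> reward (\<lambda>t. q + b * Z t - r (Z t)) Z t"
        using T2(3)[OF t(1,2)] rew_0 unfolding u_def[abs_def] by linarith
    qed (use T in auto)
    moreover have "V (Z T) - \<rho> * T * V x - \<kappa> / 2 * T \<le> exp (- \<rho> * T) * V (Z T)"
    proof -
      have "\<bar>exp (- \<rho> * T) * V (Z T) - (V (Z T) - \<rho> * T * V x)\<bar> \<le> \<kappa> / 2 * T"
        using T near Z0 by (intro d(2)) auto
      then show ?thesis by linarith
    qed
    ultimately show "0 \<le> x + q * T \<and> V (x + q * T) + T * (ln u0 - c * x\<^sup>2 - \<rho> * V x - \<kappa>) \<le> V x"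
      using Z0 by (simp add: Z_def algebra_simps)
  qed
qed

text \<open>
  The tangent line of the logarithm at \<open>q\<close> bounds the reward by an affine function of the
  control, whose integral is the increment of the state plus \<open>\<integral> (b X - r X)\<close>. The estimate is
  therefore uniform over all controls, however large, as long as the path stays near \<open>x\<close>.
\<close>

lemma payoff_le_while_near_start:
  assumes x: "0 \<le> x" and q: "0 < q" and \<kappa>: "0 < \<kappa>"
  obtains d where "0 < d"
    "\<And>u X T. regular_path x u X \<Longrightarrow> 0 \<le> T \<Longrightarrow> T \<le> d \<Longrightarrow> (\<And>s. 0 \<le> s \<Longrightarrow> s \<le> T \<Longrightarrow> \<bar>X s - x\<bar> \<le> d) \<Longrightarrow>
      payoff u X \<le> V (X T) + (X T - x) / q
        + T * (ln q - 1 - c * x\<^sup>2 + (b * x - r x) / q - \<rho> * V x + \<kappa>)"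
proof -
  \<comment> \<open>The integrand that remains, as a function of time and state, once the control is eliminated.\<close>
  define f where "f = (\<lambda>p. exp (- \<rho> * fst p) * (ln q - 1 - c * (snd p)\<^sup>2) + (b * snd p - r (snd p)) / q)"
  have "continuous_on ({0..} \<times> {0..}) f"
    unfolding f_def using q by (intro continuous_intros r_continuous_on_compose) auto
  then obtain d1 where d1: "0 < d1" "\<And>s y. 0 \<le> s \<Longrightarrow> s \<le> d1 \<Longrightarrow> 0 \<le> y \<Longrightarrow> \<bar>y - x\<bar> \<le> d1 \<Longrightarrow>
      \<bar>f (s, y) - f (0, x)\<bar> \<le> \<kappa> / 2"
    using continuous_uniform_near_initial[of f x "\<kappa> / 2"] x \<kappa> by auto
  obtain d2 where d2: "0 < d2" "\<And>T y. 0 \<le> T \<Longrightarrow> T \<le> d2 \<Longrightarrow> 0 \<le> y \<Longrightarrow> \<bar>y - x\<bar> \<le> d2 \<Longrightarrow>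
      \<bar>exp (- \<rho> * T) * V y - (V y - \<rho> * T * V x)\<bar> \<le> \<kappa> / 2 * T"
    using discounted_V_expansion[OF x, of "\<kappa> / 2"] \<kappa> by auto
  show ?thesis
  proof (rule that[of "min d1 d2"])
    show "0 < min d1 d2" using d1 d2 by simp
    fix u X T assume reg: "regular_path x u X" and T: "0 \<le> T" "T \<le> min d1 d2"
      and near: "\<And>s. 0 \<le> s \<Longrightarrow> s \<le> T \<Longrightarrow> \<bar>X s - x\<bar> \<le> min d1 d2"
    note p = regular_pathD[OF reg]
    have sol: "solves T x u X" using controlled_pathD(2)[OF p(1) T(1)] .
    have X: "0 \<le> X s" if "0 \<le> s" "s \<le> T" for s using solvesD(3)[OF sol that] .
    have int_r: "set_integrable lborel {0..T} (reward u X)"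
      using p(2) by (auto intro: set_integrable_subset)
    have int_bx: "set_integrable lborel {0..T} (\<lambda>s. b * X s - r (X s))"
      using solvesD(2)[OF sol] X by (intro borel_integrable_atLeastAtMost' continuous_intros r_continuous_on_compose) auto
    have int_u: "set_integrable lborel {0..T} (\<lambda>s. u s / q)"
      using solvesD(1)[OF sol] by (rule set_integrable_divide)
    have int_bxq: "set_integrable lborel {0..T} (\<lambda>s. (b * X s - r (X s)) / q)"
      using int_bx by (rule set_integrable_divide)
    have "(LINT s:{0..T}|lborel. reward u X s) \<le> (LINT s:{0..T}|lborel. f (0, x) + \<kappa> / 2 - (b * X s - r (X s)) / q + u s / q)"
    proof (rule set_integral_mono[OF int_r])
      show "set_integrable lborel {0..T} (\<lambda>s. f (0, x) + \<kappa> / 2 - (b * X s - r (X s)) / q + u s / q)"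
        using int_bxq int_u set_integrable_Icc_const by (intro set_integral_add(1) set_integral_diff(1))
      fix s assume "s \<in> {0..T}"
      then have s: "0 \<le> s" "s \<le> T" by auto
      have us: "0 < u s" using controlled_pathD(1)[OF p(1) s(1)] .
      have "ln (u s / q) \<le> u s / q - 1" using us q by (intro ln_le_minus_one) simp
      then have "ln (u s) \<le> ln q - 1 + u s / q" using us q by (simp add: ln_div)
      then have "reward u X s \<le> exp (- \<rho> * s) * ((ln q - 1 - c * (X s)\<^sup>2) + u s / q)"
        unfolding reward_def by (intro mult_left_mono) auto
      also have "\<dots> \<le> exp (- \<rho> * s) * (ln q - 1 - c * (X s)\<^sup>2) + u s / q"
      proof -
        have "exp (- \<rho> * s) * (u s / q) \<le> u s / q"
          using us q s \<rho>_pos by (intro mult_left_le_one_le) auto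
        then show ?thesis by (simp add: distrib_left)
      qed
      also have "\<dots> = f (s, X s) - (b * X s - r (X s)) / q + u s / q" by (simp add: f_def)
      also have "f (s, X s) \<le> f (0, x) + \<kappa> / 2"
      proof -
        have "\<bar>f (s, X s) - f (0, x)\<bar> \<le> \<kappa> / 2"
          using s T X[OF s] near[OF s] by (intro d1(2)) auto
        then show ?thesis by linarith
      qed
      finally show "reward u X s \<le> f (0, x) + \<kappa> / 2 - (b * X s - r (X s)) / q + u s / q" by simp
    qed
    also have "\<dots> = T * (f (0, x) + \<kappa> / 2) - (LINT s:{0..T}|lborel. b * X s - r (X s)) / q + (LINT s:{0..T}|lborel. u s) / q"
      using set_integral_add(2)[OF set_integral_diff(1)[OF set_integrable_Icc_const int_bxq] int_u]
        set_integral_diff(2)[OF set_integrable_Icc_const int_bxq] set_integral_Icc_const[OF T(1)]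
      by simp
    also have "\<dots> = T * (f (0, x) + \<kappa> / 2) + (X T - x) / q"
      using control_integral[OF sol order.refl T(1) order.refl] solves_initial[OF sol T(1)] q
      by (simp add: field_simps)
    finally have "(LINT s:{0..T}|lborel. reward u X s) \<le> T * (f (0, x) + \<kappa> / 2) + (X T - x) / q" .
    moreover have "exp (- \<rho> * T) * V (X T) \<le> V (X T) - \<rho> * T * V x + \<kappa> / 2 * T"
    proof -
      have "\<bar>exp (- \<rho> * T) * V (X T) - (V (X T) - \<rho> * T * V x)\<bar> \<le> \<kappa> / 2 * T"
        using T X[of T] near[of T] by (intro d2(2)) auto
      then show ?thesis by linarith
    qed
    moreover have "f (0, x) = ln q - 1 - c * x\<^sup>2 + (b * x - r x) / q" by (simp add: f_def)
    ultimately have "payoff u X \<le> T * (ln q - 1 - c * x\<^sup>2 + (b * x - r x) / q + \<kappa> / 2) + (X T - x) / q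
        + (V (X T) - \<rho> * T * V x + \<kappa> / 2 * T)"
      using payoff_split[OF reg T(1)] by simp
    also have "\<dots> = V (X T) + (X T - x) / q + T * (ln q - 1 - c * x\<^sup>2 + (b * x - r x) / q - \<rho> * V x + \<kappa>)"
      by (simp add: algebra_simps)
    finally show "payoff u X \<le> V (X T) + (X T - x) / q
        + T * (ln q - 1 - c * x\<^sup>2 + (b * x - r x) / q - \<rho> * V x + \<kappa>)" .
  qed
qed

section \<open>The viscosity properties\<close>

lemma V_supersolution: "viscosity_supersolution \<rho> (hamiltonian b c r) {0<..} V"
  unfolding viscosity_supersolution_def
proof (intro allI ballI impI)
  fix \<phi> and x :: real
  assume x: "x \<in> {0<..}" and smooth: "smooth \<phi>" and min: "local_min_rel (\<lambda>y. V y - \<phi> y) {0<..} x"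
  define D where "D = deriv \<phi> x"
  have "(deriv ^^ 0) \<phi> differentiable at x" using smooth unfolding smooth_def by blast
  then have D: "(\<phi> has_real_derivative D) (at x)"
    by (simp add: D_def DERIV_deriv_iff_real_differentiable)
  obtain d1 where d1: "0 < d1" "\<And>y. 0 < y \<Longrightarrow> \<bar>y - x\<bar> < d1 \<Longrightarrow> V x - \<phi> x \<le> V y - \<phi> y"
    using min unfolding local_min_rel_def eventually_at dist_real_def by (metis greaterThan_iff order.refl)
  have "hamiltonian b c r x D \<le> ereal (\<rho> * V x)"
    unfolding hamiltonian_def
  proof (rule SUP_least)
    fix u0 :: real assume "u0 \<in> {0<..}"
    then have u0: "0 < u0" by simp
    define q where "q = u0 - b * x + r x"
    have "q * D \<le> - (ln u0 - c * x\<^sup>2 - \<rho> * V x) + \<kappa>" if \<kappa>: "0 < \<kappa>" for \<kappa>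
    proof -
      obtain d where d: "0 < d" "\<And>T. 0 \<le> T \<Longrightarrow> T \<le> d \<Longrightarrow>
          0 \<le> x + q * T \<and> V (x + q * T) + T * (ln u0 - c * x\<^sup>2 - \<rho> * V x - \<kappa>) \<le> V x"
        using V_ge_after_constant_speed[OF _ u0 q_def _ \<kappa>] x by auto
      have "((\<lambda>T. \<phi> (x + q * T)) has_real_derivative D * q) (at 0)"
        using D by (intro DERIV_chain2[where g = "\<lambda>T. x + q * T" and f = \<phi>]) (auto intro!: derivative_eq_intros)
      then have "((\<lambda>T. (\<phi> (x + q * T) - \<phi> x) / T) \<longlongrightarrow> D * q) (at 0)"
        by (simp add: has_field_derivative_iff)
      then have lim: "((\<lambda>T. (\<phi> (x + q * T) - \<phi> x) / T) \<longlongrightarrow> D * q) (at_right 0)"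
        by (rule filterlim_mono) (auto simp: at_le)
      have "((\<lambda>T. x + q * T) \<longlongrightarrow> x + q * 0) (at_right 0)" by (intro tendsto_intros)
      then have "\<forall>\<^sub>F T in at_right 0. dist (x + q * T) x < min d1 x"
        using d1(1) x by (auto dest!: tendstoD[where e = "min d1 x"])
      moreover have "\<forall>\<^sub>F T in at_right 0. 0 < T \<and> T < d"
        using d(1) by (auto simp: eventually_at_right_field)
      ultimately have ev: "\<forall>\<^sub>F T in at_right 0. (\<phi> (x + q * T) - \<phi> x) / T \<le> - (ln u0 - c * x\<^sup>2 - \<rho> * V x) + \<kappa>"
      proof eventually_elim
        case (elim T)
        then have "0 < x + q * T" "\<bar>x + q * T - x\<bar> < d1" by (auto simp: dist_real_def abs_if split: if_splits)
        then have "V x - \<phi> x \<le> V (x + q * T) - \<phi> (x + q * T)" by (rule d1(2))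
        moreover have "V (x + q * T) + T * (ln u0 - c * x\<^sup>2 - \<rho> * V x - \<kappa>) \<le> V x" using d(2)[of T] elim by simp
        ultimately have "\<phi> (x + q * T) - \<phi> x \<le> (- (ln u0 - c * x\<^sup>2 - \<rho> * V x) + \<kappa>) * T"
          by (simp add: algebra_simps)
        then show ?case using elim by (simp add: pos_divide_le_eq)
      qed
      show ?thesis using tendsto_upperbound[OF lim ev] by (simp add: mult.commute)
    qed
    then have "q * D \<le> - (ln u0 - c * x\<^sup>2 - \<rho> * V x)" by (rule field_le_epsilon)
    then show "ereal ((u0 - b * x + r x) * D + ln u0 - c * x\<^sup>2) \<le> ereal (\<rho> * V x)"
      by (simp add: q_def)
  qed
  then show "0 \<le> ereal (\<rho> * V x) - hamiltonian b c r x (deriv \<phi> x)"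
    unfolding D_def by (simp add: ereal_diff_positive)
qed

text \<open>
  Only slopes \<open>p < 0\<close> are at issue. If the inequality failed at \<open>x\<close>, it would fail by \<open>\<theta>\<close> at the
  slightly larger slope \<open>p2 = p + 2 \<eta>\<close> too, and a nearly optimal path would lose \<open>\<theta> T/2\<close> up to
  its exit time \<open>T\<close> from a neighbourhood of \<open>x\<close>. The change of slope makes an exit to the right
  cost an extra \<open>\<eta> R\<close>, however early it occurs. An exit to the left, favoured by the change of
  slope, takes a time bounded below, since the state decreases at speed at most \<open>b (x + 1)\<close>. In
  every case the loss has a positive lower bound, which contradicts near optimality.
\<close>

lemma V_subsolution: "viscosity_subsolution \<rho> (hamiltonian b c r) {0..} V"
  unfolding viscosity_subsolution_def
proof (intro allI ballI impI)
  fix \<phi> and x :: real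
  assume "x \<in> {0..}" and smooth: "smooth \<phi>" and max: "local_max_rel (\<lambda>y. V y - \<phi> y) {0..} x"
  then have x: "0 \<le> x" by simp
  define p where "p = deriv \<phi> x"
  have "(deriv ^^ 0) \<phi> differentiable at x" using smooth unfolding smooth_def by blast
  then have D: "(\<phi> has_real_derivative p) (at x)"
    by (simp add: p_def DERIV_deriv_iff_real_differentiable)
  obtain d1 where d1: "0 < d1" "\<And>y. 0 \<le> y \<Longrightarrow> \<bar>y - x\<bar> < d1 \<Longrightarrow> V y - \<phi> y \<le> V x - \<phi> x"
    using max unfolding local_max_rel_def eventually_at dist_real_def by (metis atLeast_iff order.refl)
  show "ereal (\<rho> * V x) - hamiltonian b c r x (deriv \<phi> x) \<le> 0"
  proof (cases "0 \<le> p")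
    case True
    then show ?thesis by (simp add: p_def hamiltonian_nonneg)
  next
    case False
    then have p: "p < 0" by simp
    define h where "h p = (r x - b * x) * p - ln (- p) - 1 - c * x\<^sup>2" for p
    have "\<rho> * V x \<le> h p"
    proof (rule ccontr)
      assume less: "\<not> ?thesis"
      define \<theta> where "\<theta> = (\<rho> * V x - h p) / 2"
      have \<theta>: "0 < \<theta>" using less by (simp add: \<theta>_def)
      have "isCont h p" unfolding h_def[abs_def] using p by (intro continuous_intros) auto
      then obtain e0 where e0: "0 < e0" "\<And>p'. \<bar>p' - p\<bar> < e0 \<Longrightarrow> \<bar>h p' - h p\<bar> < \<theta>"
        using \<theta> unfolding continuous_at_eps_delta dist_real_def by metis
      \<comment> \<open>The last bound keeps the gain of a path that moves to the left below a quarter of \<theta> per unit time.\<close>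
      define \<eta> where "\<eta> = min (min (e0 / 4) (- p / 4)) (\<theta> / (12 * b * (x + 1)))"
      have \<eta>: "0 < \<eta>" "2 * \<eta> < e0" "p + 2 * \<eta> < 0" "3 * \<eta> * (b * (x + 1)) \<le> \<theta> / 4"
      proof -
        show "0 < \<eta>" using e0 p \<theta> b_pos x by (simp add: \<eta>_def)
        have "\<eta> \<le> e0 / 4" "\<eta> \<le> - p / 4" "\<eta> \<le> \<theta> / (12 * b * (x + 1))" by (simp_all add: \<eta>_def)
        then show "2 * \<eta> < e0" "p + 2 * \<eta> < 0" using e0(1) p by simp_all
        have "0 < 12 * b * (x + 1)" using b_pos x by simp
        then have "\<eta> * (12 * b * (x + 1)) \<le> \<theta>"
          using \<open>\<eta> \<le> \<theta> / (12 * b * (x + 1))\<close> by (simp only: pos_le_divide_eq)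
        then show "3 * \<eta> * (b * (x + 1)) \<le> \<theta> / 4" by simp
      qed
      define p2 where "p2 = p + 2 * \<eta>"
      have p2: "p2 < 0" using \<eta>(3) by (simp add: p2_def)
      have h_p2_less: "h p2 < \<rho> * V x - \<theta>"
      proof -
        have "\<bar>h p2 - h p\<bar> < \<theta>" using \<eta>(1,2) by (intro e0(2)) (simp add: p2_def)
        moreover have "h p = \<rho> * V x - 2 * \<theta>" by (simp add: \<theta>_def field_simps)
        ultimately show ?thesis by linarith
      qed
      obtain d2 where d2: "0 < d2"
        "\<And>u X T. regular_path x u X \<Longrightarrow> 0 \<le> T \<Longrightarrow> T \<le> d2 \<Longrightarrow> (\<And>s. 0 \<le> s \<Longrightarrow> s \<le> T \<Longrightarrow> \<bar>X s - x\<bar> \<le> d2) \<Longrightarrow>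
          payoff u X \<le> V (X T) + (X T - x) / (- 1 / p2)
            + T * (ln (- 1 / p2) - 1 - c * x\<^sup>2 + (b * x - r x) / (- 1 / p2) - \<rho> * V x + \<theta> / 2)"
        using payoff_le_while_near_start[OF x, of "- 1 / p2" "\<theta> / 2"] p2 \<theta> by (auto simp: field_simps)
      have h_p2: "ln (- 1 / p2) - 1 - c * x\<^sup>2 + (b * x - r x) / (- 1 / p2) = h p2"
      proof -
        have "ln (- 1 / p2) = - ln (- p2)"
          using p2 ln_inverse[of "- p2"] by (simp add: field_simps inverse_eq_divide)
        then show ?thesis by (simp add: h_def algebra_simps)
      qed
      obtain d3 where d3: "0 < d3" "\<And>y. \<bar>y - x\<bar> < d3 \<Longrightarrow> \<bar>\<phi> y - \<phi> x - p * (y - x)\<bar> \<le> \<eta> * \<bar>y - x\<bar>"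
        using D \<eta>(1) unfolding has_field_derivative_def has_derivative_at_alt
        by (auto simp: mult.commute)
      define R where "R = min (min (d1 / 2) d2) (min (d3 / 2) 1)"
      have R: "0 < R" "R < d1" "R \<le> d2" "R < d3" "R \<le> 1"
        using d1(1) d2(1) d3(1) by (auto simp: R_def)
      \<comment> \<open>The losses in the three cases: no exit before time R, exit to the right, exit to the left.\<close>
      define \<epsilon> where "\<epsilon> = min (min (R * \<theta> / 4) (\<eta> * R)) (\<theta> / 4 * (R / (b * (x + 1))))"
      have \<epsilon>_le: "\<epsilon> \<le> R * \<theta> / 4" "\<epsilon> \<le> \<eta> * R" "\<epsilon> \<le> \<theta> / 4 * (R / (b * (x + 1)))"
        by (simp_all only: \<epsilon>_def min_le_iff_disj order.refl simp_thms)
      have \<epsilon>: "0 < \<epsilon>" using R(1) \<theta> \<eta>(1) b_pos x by (simp add: \<epsilon>_def)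
      obtain u X where reg: "regular_path x u X" and opt: "V x - \<epsilon> < payoff u X"
        using nearly_optimal_path[OF x \<epsilon>] .
      note path = regular_pathD(1)[OF reg]
      have X0: "X 0 = x" using solves_initial[OF controlled_pathD(2)[OF path]] by blast
      obtain T where T: "0 \<le> T" "T \<le> R" "\<And>s. 0 \<le> s \<Longrightarrow> s \<le> T \<Longrightarrow> \<bar>X s - x\<bar> \<le> R"
        and exit: "T = R \<or> \<bar>X T - x\<bar> = R"
        using first_exit_time[of R X R] continuous_on_subset[OF controlled_path_continuous[OF path]] R(1)
        by (auto simp: X0)
      have sol: "solves T x u X" using controlled_pathD(2)[OF path T(1)] .
      define y where "y = X T"
      have y: "0 \<le> y" "\<bar>y - x\<bar> \<le> R" using solvesD(3)[OF sol T(1)] T by (auto simp: y_def)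
      have "payoff u X \<le> V y - p2 * (y - x) + T * (h p2 - \<rho> * V x + \<theta> / 2)"
        using d2(2)[OF reg T(1)] T R unfolding h_p2 y_def by (force simp: algebra_simps)
      also have "\<dots> \<le> V y - p2 * (y - x) + T * (- \<theta> / 2)"
        using h_p2_less T(1) by (intro add_left_mono mult_left_mono) auto
      also have "V y \<le> V x + p * (y - x) + \<eta> * \<bar>y - x\<bar>"
        using d1(2)[of y] d3(2)[of y] y R by (auto simp: abs_le_iff)
      finally have main: "payoff u X \<le> V x - 2 * \<eta> * (y - x) + \<eta> * \<bar>y - x\<bar> - T * \<theta> / 2"
        by (simp add: p2_def algebra_simps)
      have slow_return: "x - y \<le> T * (b * (x + 1))"
      proof -
        have "(LINT s:{0..T}|lborel. - (b * (x + 1))) \<le> (LINT s:{0..T}|lborel. drift u X s)"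
        proof (rule set_integral_mono[OF set_integrable_Icc_const drift_integrable[OF sol]])
          fix s assume "s \<in> {0..T}"
          then have s: "0 \<le> s" "s \<le> T" by auto
          have "b * X s \<le> b * (x + 1)" using T(3)[OF s] R(5) b_pos by (intro mult_left_mono) auto
          then show "- (b * (x + 1)) \<le> drift u X s"
            using controlled_pathD(1)[OF path s(1)] r_nonneg[OF solvesD(3)[OF sol s]] by (simp add: drift_def)
        qed
        then show ?thesis
          using solvesD(4)[OF sol T(1) order.refl] set_integral_Icc_const[OF T(1), of "- (b * (x + 1))"]
          by (simp add: y_def)
      qed
      show False
      proof (cases "x \<le> y")
        case True
        then have gap: "\<eta> * (y - x) + T * \<theta> / 2 < \<epsilon>" using main opt by (simp add: algebra_simps)
        have nn: "0 \<le> \<eta> * (y - x)" "0 \<le> T * \<theta> / 2" using True \<eta>(1) T(1) \<theta> by auto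
        from exit show False
        proof
          assume "T = R"
          then have "R * \<theta> / 2 < \<epsilon>" using gap nn by simp
          moreover have "\<epsilon> \<le> R * \<theta> / 4" by (rule \<epsilon>_le)
          moreover have "0 < R * \<theta>" using R(1) \<theta> by simp
          ultimately show False by linarith
        next
          assume "\<bar>X T - x\<bar> = R"
          then have "y - x = R" using True by (simp add: y_def)
          then have "\<eta> * R < \<epsilon>" using gap nn by simp
          then show False using \<epsilon>_le(2) by simp
        qed
      next
        case False
        have "3 * \<eta> * (x - y) \<le> 3 * \<eta> * (T * (b * (x + 1)))" using slow_return \<eta>(1) by (intro mult_left_mono) auto
        also have "\<dots> = T * (3 * \<eta> * (b * (x + 1)))" by simp
        also have "\<dots> \<le> T * (\<theta> / 4)" using \<eta>(4) T(1) by (rule mult_left_mono)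
        finally have gap: "T * \<theta> / 4 < \<epsilon>" using main opt False by (simp add: algebra_simps)
        from exit show False
        proof
          assume "T = R"
          then show False using gap \<epsilon>_le(1) by simp
        next
          assume "\<bar>X T - x\<bar> = R"
          then have "x - y = R" using False by (simp add: y_def)
          then have "R / (b * (x + 1)) \<le> T" using slow_return b_pos x by (simp add: pos_divide_le_eq)
          then have "\<theta> / 4 * (R / (b * (x + 1))) \<le> \<theta> / 4 * T" using \<theta> by (intro mult_left_mono) auto
          then have "\<epsilon> \<le> \<theta> / 4 * T" by (rule order.trans[OF \<epsilon>_le(3)])
          then show False using gap by (simp add: mult.commute)
        qed
      qed
    qed
    then show ?thesis
      using hamiltonian_neg[OF p, of b c r x] by (simp add: p_def[symmetric] h_def)
  qed
qed

section \<open>The boundary derivative\<close>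

text \<open>
  From above: moving with speed \<open>u0 = exp (1 + \<rho> V 0)\<close> reaches \<open>h\<close> at time \<open>h/u0\<close>.
  From below: a path from \<open>0\<close> that is optimal up to \<open>h\<^sup>2\<close> reaches \<open>h\<close> within a time of order \<open>h\<close>,
  for otherwise its control would be too small on average; the upper estimate for \<open>q = u0\<close>,
  evaluated when it reaches \<open>h\<close>, bounds \<open>V h\<close> from below.
\<close>

lemma V_derivative_at_0:
  "(V has_real_derivative - exp (- 1 - \<rho> * V 0)) (at 0 within {0..})"
proof -
  define u0 where "u0 = exp (1 + \<rho> * V 0)"
  define p0 where "p0 = exp (- 1 - \<rho> * V 0)"
  have u0: "0 < u0" "ln u0 = 1 + \<rho> * V 0" "1 / u0 = p0" "u0 * p0 = 1"
    by (simp_all add: u0_def p0_def exp_minus[symmetric] inverse_eq_divide[symmetric] exp_add[symmetric])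
  have p0: "0 < p0" by (simp add: p0_def)
  have upper: "\<forall>\<^sub>F h in at_right 0. (V h - V 0) / h < - p0 + e" if e: "0 < e" for e
  proof -
    define \<kappa> where "\<kappa> = e / (2 * p0)"
    have \<kappa>: "0 < \<kappa>" "p0 * \<kappa> < e" using e p0 by (auto simp: \<kappa>_def)
    obtain d where d: "0 < d" "\<And>T. 0 \<le> T \<Longrightarrow> T \<le> d \<Longrightarrow> V (u0 * T) + T * (1 - \<kappa>) \<le> V 0"
      using V_ge_after_constant_speed[of 0 u0 u0 \<kappa>] u0 r_0 \<kappa>(1) by auto
    have "(V h - V 0) / h < - p0 + e" if h: "0 < h" "h < d / p0" for h
    proof -
      have "p0 * h \<le> d" using h p0 by (simp add: field_simps)
      then have "V (u0 * (p0 * h)) + (p0 * h) * (1 - \<kappa>) \<le> V 0" using h p0 by (intro d(2)) auto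
      moreover have "u0 * (p0 * h) = h" using u0(4) by (simp add: mult.assoc[symmetric])
      ultimately have "V h + (p0 * h) * (1 - \<kappa>) \<le> V 0" by (simp only:)
      then have "V h - V 0 \<le> (- p0 + p0 * \<kappa>) * h" by (simp add: algebra_simps)
      then have "(V h - V 0) / h \<le> - p0 + p0 * \<kappa>" using h by (simp add: pos_divide_le_eq)
      then show ?thesis using \<kappa>(2) by simp
    qed
    then show ?thesis using d(1) p0 by (auto simp: eventually_at_right_field intro!: exI[of _ "d / p0"])
  qed
  have lower: "\<forall>\<^sub>F h in at_right 0. - p0 - e < (V h - V 0) / h" if e: "0 < e" for e
  proof -
    \<comment> \<open>For this q, below the critical value u0, time spent near 0 is a loss; this bounds the hitting time.\<close>
    define q where "q = exp (\<rho> * V 0)"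
    define C where "C = 2 + 2 / q"
    define \<kappa> where "\<kappa> = e / (2 * C)"
    have q: "0 < q" "ln q = \<rho> * V 0" by (simp_all add: q_def)
    have C: "0 < C" using q(1) by (simp add: C_def add_pos_pos)
    have \<kappa>: "0 < \<kappa>" "\<kappa> * C = e / 2" using e C by (auto simp: \<kappa>_def)
    obtain d1 where d1: "0 < d1"
      "\<And>u X T. regular_path 0 u X \<Longrightarrow> 0 \<le> T \<Longrightarrow> T \<le> d1 \<Longrightarrow> (\<And>s. 0 \<le> s \<Longrightarrow> s \<le> T \<Longrightarrow> \<bar>X s\<bar> \<le> d1) \<Longrightarrow>
        payoff u X \<le> V (X T) + X T / q - T / 2"
      using payoff_le_while_near_start[of 0 q "1 / 2"] q r_0 by auto
    obtain d2 where d2: "0 < d2"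
      "\<And>u X T. regular_path 0 u X \<Longrightarrow> 0 \<le> T \<Longrightarrow> T \<le> d2 \<Longrightarrow> (\<And>s. 0 \<le> s \<Longrightarrow> s \<le> T \<Longrightarrow> \<bar>X s\<bar> \<le> d2) \<Longrightarrow>
        payoff u X \<le> V (X T) + X T * p0 + T * \<kappa>"
      using payoff_le_while_near_start[of 0 u0 \<kappa>] u0 r_0 \<kappa>(1) by (auto simp: divide_inverse)
    define d where "d = min d1 d2"
    define h0 where "h0 = min (min 1 d) (min (d / C) (e / 2))"
    have "- p0 - e < (V h - V 0) / h" if h: "0 < h" "h < h0" for h
    proof -
      have h': "h < 1" "h < d" "h < d / C" "h < e / 2" using h by (auto simp: h0_def)
      obtain u X where reg: "regular_path 0 u X" and opt: "V 0 - h\<^sup>2 < payoff u X"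
        using nearly_optimal_path[of 0 "h\<^sup>2"] h by auto
      note path = regular_pathD(1)[OF reg]
      have X0: "X 0 = 0" using solves_initial[OF controlled_pathD(2)[OF path]] by blast
      have "0 \<le> d" using d1(1) d2(1) by (simp add: d_def)
      then obtain T where T: "0 \<le> T" "T \<le> d" "\<And>s. 0 \<le> s \<Longrightarrow> s \<le> T \<Longrightarrow> \<bar>X s\<bar> \<le> h"
        and exit: "T = d \<or> \<bar>X T\<bar> = h"
        using first_exit_time[of d X h] continuous_on_subset[OF controlled_path_continuous[OF path]] h(1)
        by (auto simp: X0)
      have XT: "0 \<le> X T" "X T \<le> h" using controlled_pathD(3)[OF path T(1)] T(3)[of T] T(1) by auto
      have "payoff u X \<le> V (X T) + X T / q - T / 2"
        using T h' by (intro d1(2)[OF reg]) (force simp: d_def)+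
      moreover have "V (X T) \<le> V 0" using V_antimono[of 0 "X T"] XT by simp
      moreover have "X T / q \<le> h / q" using XT q by (simp add: divide_right_mono)
      moreover have "h\<^sup>2 \<le> h" using h h' by (simp add: power2_eq_square mult_left_le)
      ultimately have "T \<le> 2 * (h + h / q)" using opt by argo
      also have "\<dots> = C * h" by (simp add: C_def algebra_simps)
      finally have T_le: "T \<le> C * h" .
      have "C * h < d" using h'(3) C by (simp add: field_simps)
      then have XTh: "X T = h" using exit T_le XT by auto
      have "payoff u X \<le> V h + h * p0 + T * \<kappa>"
        using T h' d2(2)[OF reg, of T] unfolding XTh by (force simp: d_def)
      moreover have "T * \<kappa> \<le> e / 2 * h"
      proof -
        have "T * \<kappa> \<le> (C * h) * \<kappa>" using T_le \<kappa>(1) by (intro mult_right_mono) auto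
        also have "\<dots> = (\<kappa> * C) * h" by (simp only: ac_simps)
        finally show ?thesis by (simp only: \<kappa>(2))
      qed
      moreover have "h\<^sup>2 < e / 2 * h" using h' h by (simp add: power2_eq_square)
      ultimately have "(- p0 - e) * h < V h - V 0" using opt by (simp add: algebra_simps)
      then show ?thesis using h by (simp add: pos_less_divide_eq)
    qed
    moreover have "0 < h0" using d1(1) d2(1) C e by (simp add: h0_def d_def)
    ultimately show ?thesis by (auto simp: eventually_at_right_field)
  qed
  have "((\<lambda>h. (V h - V 0) / h) \<longlongrightarrow> - p0) (at_right 0)"
  proof (rule order_tendstoI)
    fix l assume "l < - p0"
    then show "\<forall>\<^sub>F h in at_right 0. l < (V h - V 0) / h" using lower[of "- p0 - l"] by simp
  next
    fix l assume "- p0 < l"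
    then show "\<forall>\<^sub>F h in at_right 0. (V h - V 0) / h < l" using upper[of "l + p0"] by simp
  qed
  moreover have "at_right 0 = at (0::real) within {0..}"
    by (rule at_within_nhd[of _ UNIV]) auto
  ultimately show ?thesis by (simp add: has_field_derivative_iff p0_def)
qed

end

section \<open>From paths to the stochastic control problem\<close>

lemma ext_integral_mono_AE:
  assumes "AE y in N. f y \<le> g y"
  shows "ext_integral N f \<le> ext_integral N g"
  unfolding ext_integral_def
proof (intro ereal_minus_mono)
  have "AE y in N. e2ennreal (f y) \<le> e2ennreal (g y)"
    using assms by eventually_elim (rule e2ennreal_mono)
  then show "enn2ereal (\<integral>\<^sup>+ y. e2ennreal (f y) \<partial>N) \<le> enn2ereal (\<integral>\<^sup>+ y. e2ennreal (g y) \<partial>N)"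
    by (simp add: less_eq_ennreal.rep_eq[symmetric] nn_integral_mono_AE)
  have "AE y in N. e2ennreal (- g y) \<le> e2ennreal (- f y)"
    using assms by eventually_elim (simp add: e2ennreal_mono)
  then show "enn2ereal (\<integral>\<^sup>+ y. e2ennreal (- g y) \<partial>N) \<le> enn2ereal (\<integral>\<^sup>+ y. e2ennreal (- f y) \<partial>N)"
    by (simp add: less_eq_ennreal.rep_eq[symmetric] nn_integral_mono_AE)
qed

lemma ext_integral_cong_AE:
  assumes "AE y in N. f y = g y"
  shows "ext_integral N f = ext_integral N g"
  using assms by (intro antisym ext_integral_mono_AE) (auto elim!: eventually_mono)

lemma (in prob_space) ext_integral_const: "ext_integral M (\<lambda>_. ereal k) = ereal k"
  using ext_integral_eq_integral[of M "\<lambda>_. k"] by (simp add: prob_space)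

lemma integrable_half_line: "integrable half_line f \<longleftrightarrow> set_integrable lborel {0..} (f :: real \<Rightarrow> real)"
  by (simp add: half_line_def integrable_restrict_space set_integrable_def)

lemma integral_half_line: "integral\<^sup>L half_line f = (LINT t:{0..}|lborel. (f t :: real))"
  by (simp add: half_line_def integral_restrict_space set_lebesgue_integral_def)

lemma measurable_half_line: "f \<in> borel_measurable half_line \<longleftrightarrow> set_borel_measurable lborel {0..} (f :: real \<Rightarrow> real)"
  by (simp add: half_line_def borel_measurable_restrict_space_iff set_borel_measurable_def)

lemma space_half_line: "space half_line = {0..}"
  by (simp add: half_line_def space_restrict_space)

context lake
begin

text \<open>
  If the reward is not integrable, its negative part has an infinite integral while that of its
  positive part is finite.
\<close>

lemma ext_integral_reward_le_V:
  assumes path: "controlled_path x u X"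
  shows "ext_integral half_line (\<lambda>t. ereal (reward u X t)) \<le> ereal (V x)"
proof (cases "regular_path x u X")
  case True
  then show ?thesis
    using ext_integral_eq_integral[of half_line "reward u X"] payoff_le_V[OF True] regular_pathD(2)[OF True]
    by (simp add: integrable_half_line integral_half_line payoff_def)
next
  case False
  let ?P = "\<integral>\<^sup>+ t. ennreal (reward u X t) \<partial>half_line" and ?N = "\<integral>\<^sup>+ t. ennreal (- reward u X t) \<partial>half_line"
  have "integrable half_line (\<lambda>t. exp (- \<rho> * t) * max 0 (ln (u t) - c * (X t)\<^sup>2))"
    using net_benefit_positive_part(1)[OF path c_pos] by (simp add: integrable_half_line)
  then have "(\<integral>\<^sup>+ t. ennreal (exp (- \<rho> * t) * max 0 (ln (u t) - c * (X t)\<^sup>2)) \<partial>half_line) \<noteq> \<infinity>"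
    by (simp add: real_integrable_def)
  moreover have "?P \<le> (\<integral>\<^sup>+ t. ennreal (exp (- \<rho> * t) * max 0 (ln (u t) - c * (X t)\<^sup>2)) \<partial>half_line)"
    by (intro nn_integral_mono ennreal_leI reward_le_positive_part)
  ultimately have P: "?P \<noteq> \<infinity>" by (auto simp: top_unique)
  have "\<not> integrable half_line (reward u X)"
    using False path by (simp add: regular_path_def integrable_half_line)
  moreover have "reward u X \<in> borel_measurable half_line"
    using reward_measurable[OF path] by (simp add: measurable_half_line)
  ultimately have "?N = \<infinity>" using P by (simp add: real_integrable_def)
  then have "ext_integral half_line (\<lambda>t. ereal (reward u X t)) = - \<infinity>"
    using P by (cases ?P) (auto simp: ext_integral_def enn2ereal_ennreal)
  then show ?thesis by simp
qed

end

locale lake_on_probability_space =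
  shallow_lake M F W b c \<rho> r + lake b c \<rho> r L a
  for M :: "'a measure" and F and W and b c \<rho> :: real and r :: "real \<Rightarrow> real" and L a :: real
begin

lemma strong_solution_AE_solves:
  assumes X: "strong_solution M F b r x u X"
    and u: "AE \<omega> in M. \<forall>T\<ge>0. set_integrable lborel {0..T} (\<lambda>t. u t \<omega>)"
  shows "AE \<omega> in M. \<forall>T\<ge>0. solves T x (\<lambda>t. u t \<omega>) (\<lambda>t. X t \<omega>)"
proof -
  have "AE \<omega> in M. continuous_on {0..} (\<lambda>t. X t \<omega>) \<and>
      (\<forall>t\<ge>0. X t \<omega> \<ge> 0 \<and> X t \<omega> = x + (LINT s:{0..t}|lborel. u s \<omega> - b * X s \<omega> + r (X s \<omega>)))"
    using X unfolding strong_solution_def by blast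
  with u show ?thesis
  proof eventually_elim
    case (elim \<omega>)
    have d: "drift (\<lambda>t. u t \<omega>) (\<lambda>t. X t \<omega>) = (\<lambda>s. u s \<omega> - b * X s \<omega> + r (X s \<omega>))"
      by (simp add: drift_def fun_eq_iff)
    have "continuous_on {0..T} (\<lambda>t. X t \<omega>)" for T
      using elim by (auto intro: continuous_on_subset)
    then show ?case using elim unfolding solves_def d by auto
  qed
qed

lemma solves_imp_strong_solution:
  assumes "\<And>T. 0 \<le> T \<Longrightarrow> solves T x u X"
  shows "strong_solution M F b r x (\<lambda>t _. u t) (\<lambda>t _. X t)"
proof -
  have d: "drift u X = (\<lambda>s. u s - b * X s + r (X s))" by (simp add: drift_def fun_eq_iff)
  have "continuous_on {0..} X" using solvesD(2)[OF assms] by (rule continuous_on_half_line)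
  moreover have "0 \<le> X t" if "0 \<le> t" for t
    using solvesD(3)[OF assms[OF that] that] by simp
  moreover have "X t = x + (LINT s:{0..t}|lborel. u s - b * X s + r (X s))" if "0 \<le> t" for t
    using solvesD(4)[OF assms[OF that] that] unfolding d by simp
  ultimately show ?thesis
    unfolding strong_solution_def adapted_def by (intro conjI allI impI AE_I2 measurable_const) auto
qed

lemma state_process_strong_solution:
  assumes "u \<in> admissible M F b \<rho> r x"
  shows "strong_solution M F b r x u (state_process M F b r x u)"
proof -
  have "\<exists>X. strong_solution M F b r x u X" using assms unfolding admissible_def by blast
  then show ?thesis unfolding state_process_def by (rule someI_ex)
qed

lemma benefit_le_V:
  assumes u: "u \<in> admissible M F b \<rho> r x"
  shows "benefit M F b c \<rho> r x u \<le> ereal (V x)"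
proof -
  let ?X = "state_process M F b r x u"
  have "AE \<omega> in M. \<forall>T\<ge>0. set_integrable lborel {0..T} (\<lambda>t. u t \<omega>)"
    and pos: "\<forall>t\<ge>0. \<forall>\<omega>\<in>space M. 0 < u t \<omega>"
    using u unfolding admissible_def by blast+
  then have "AE \<omega> in M. \<forall>T\<ge>0. solves T x (\<lambda>t. u t \<omega>) (\<lambda>t. ?X t \<omega>)"
    by (intro strong_solution_AE_solves state_process_strong_solution u)
  then have "AE \<omega> in M. ext_integral half_line
      (\<lambda>t. ereal (exp (- \<rho> * t) * (ln (u t \<omega>) - c * (?X t \<omega>)\<^sup>2))) \<le> ereal (V x)"
    using AE_space
  proof eventually_elim
    case (elim \<omega>)
    then have "controlled_path x (\<lambda>t. u t \<omega>) (\<lambda>t. ?X t \<omega>)"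
      using pos by (simp add: controlled_path_def)
    then show ?case using ext_integral_reward_le_V by (simp add: reward_def)
  qed
  then have "benefit M F b c \<rho> r x u \<le> ext_integral M (\<lambda>_. ereal (V x))"
    unfolding benefit_def by (rule ext_integral_mono_AE)
  then show ?thesis by (simp add: ext_integral_const)
qed

text \<open>
  Admissibility needs an integrable \<open>exp (- \<rho> t) ln u\<close>; this is the reward plus a multiple of the
  discounted square of the state.
\<close>

lemma deterministic_control:
  assumes reg: "regular_path x u X"
  shows "(\<lambda>t _. u t) \<in> admissible M F b \<rho> r x" (is "?u \<in> _")
    and "benefit M F b c \<rho> r x (\<lambda>t _. u t) = ereal (payoff u X)"
proof -
  note p = regular_pathD[OF reg]
  note sol = controlled_pathD(2)[OF p(1)]
  have int_u: "AE \<omega> in M. \<forall>T\<ge>0. set_integrable lborel {0..T} (\<lambda>t. ?u t \<omega>)"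
    using solvesD(1)[OF sol] by simp
  have X: "strong_solution M F b r x ?u (\<lambda>t _. X t)" using sol by (rule solves_imp_strong_solution)
  have unique: "AE \<omega> in M. \<forall>t\<ge>0. Y t \<omega> = X t" if "strong_solution M F b r x ?u Y" for Y
    using strong_solution_AE_solves[OF that int_u]
    by eventually_elim (auto intro: solves_unique[OF _ sol])
  have indist: "indistinguishable M Y Z"
    if "strong_solution M F b r x ?u Y" "strong_solution M F b r x ?u Z" for Y Z
    unfolding indistinguishable_def using unique[OF that(1)] unique[OF that(2)]
    by eventually_elim auto
  have "set_integrable lborel {0..} (\<lambda>t. reward u X t + c * (exp (- \<rho> * t) * (X t)\<^sup>2))"
    using p(2) square_integrable_state(1)[OF reg] by (intro set_integral_add(1) set_integrable_mult_right)
  then have "integrable half_line (\<lambda>t. exp (- \<rho> * t) * ln (u t))"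
    by (simp add: integrable_half_line reward_def algebra_simps)
  then have fin: "ext_integral M (\<lambda>\<omega>. ext_integral half_line (\<lambda>t. ereal (exp (- \<rho> * t) * ln (?u t \<omega>)))) < \<infinity>"
    by (simp add: ext_integral_eq_integral ext_integral_const)
  have "u \<in> borel_measurable half_line"
    using controlled_path_measurable(1)[OF p(1)] by (simp add: measurable_half_line)
  then have "(\<lambda>(t, \<omega>). ?u t \<omega>) \<in> borel_measurable (half_line \<Otimes>\<^sub>M M)"
    by (simp add: case_prod_beta')
  then show adm: "?u \<in> admissible M F b \<rho> r x"
    unfolding admissible_def adapted_def using int_u fin indist X controlled_pathD(1)[OF p(1)] by auto
  let ?Y = "state_process M F b r x ?u"
  have "AE \<omega> in M. \<forall>t\<ge>0. ?Y t \<omega> = X t"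
    using adm by (intro unique state_process_strong_solution)
  then have "AE \<omega> in M. ext_integral half_line (\<lambda>t. ereal (exp (- \<rho> * t) * (ln (?u t \<omega>) - c * (?Y t \<omega>)\<^sup>2)))
      = ereal (payoff u X)"
  proof eventually_elim
    case (elim \<omega>)
    have "ext_integral half_line (\<lambda>t. ereal (exp (- \<rho> * t) * (ln (?u t \<omega>) - c * (?Y t \<omega>)\<^sup>2)))
        = ext_integral half_line (\<lambda>t. ereal (reward u X t))"
      using elim by (intro ext_integral_cong_AE AE_I2) (simp add: space_half_line reward_def)
    also have "\<dots> = ereal (payoff u X)"
      using ext_integral_eq_integral[of half_line "reward u X"] p(2)
      by (simp add: integrable_half_line integral_half_line payoff_def)
    finally show ?case .
  qed
  then have "benefit M F b c \<rho> r x ?u = ext_integral M (\<lambda>_. ereal (payoff u X))"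
    unfolding benefit_def by (rule ext_integral_cong_AE)
  then show "benefit M F b c \<rho> r x ?u = ereal (payoff u X)" by (simp add: ext_integral_const)
qed

lemma value_function_eq_V:
  assumes "0 \<le> x"
  shows "value_function M F b c \<rho> r x = ereal (V x)"
proof (rule antisym)
  show "value_function M F b c \<rho> r x \<le> ereal (V x)"
    unfolding value_function_def by (intro SUP_least benefit_le_V)
  show "ereal (V x) \<le> value_function M F b c \<rho> r x"
  proof (rule ereal_le_epsilon2)
    fix e :: real assume "0 < e"
    then obtain u X where reg: "regular_path x u X" "V x - e < payoff u X"
      using nearly_optimal_path[OF assms] by blast
    have "ereal (payoff u X) \<le> value_function M F b c \<rho> r x"
      unfolding value_function_def using deterministic_control[OF reg(1)] by (metis SUP_upper)
    then have "ereal (payoff u X) + ereal e \<le> value_function M F b c \<rho> r x + ereal e"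
      by (rule add_right_mono)
    moreover have "ereal (V x) \<le> ereal (payoff u X) + ereal e" using reg(2) by simp
    ultimately show "ereal (V x) \<le> value_function M F b c \<rho> r x + ereal e" by (rule order.trans[rotated])
  qed
qed

end

text \<open>
  The derivative of \<open>r\<close> is continuous and tends to \<open>0\<close>, hence bounded.
\<close>

lemma recycling_rate_lipschitz:
  assumes "recycling_rate b \<rho> r"
  obtains L where "0 < L" "L-lipschitz_on {0..} r"
proof -
  obtain r' where r': "\<And>x. 0 \<le> x \<Longrightarrow> (r has_real_derivative r' x) (at x within {0..})"
    and cont: "continuous_on {0..} r'" and lim: "(r' \<longlongrightarrow> 0) at_top"
    using assms unfolding recycling_rate_def by blast
  have "\<forall>\<^sub>F x in at_top. dist (r' x) 0 < 1" using lim by (rule tendstoD) simp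
  then obtain N where N: "\<And>x. N \<le> x \<Longrightarrow> \<bar>r' x\<bar> < 1" by (auto simp: eventually_at_top_linorder)
  have comp: "compact (r' ` {0..N})"
    using cont by (intro compact_continuous_image) (auto intro: continuous_on_subset)
  obtain B where "\<forall>y\<in>r' ` {0..N}. norm y \<le> B"
    using compact_imp_bounded[OF comp] unfolding bounded_iff by blast
  then have B: "\<bar>r' x\<bar> \<le> B" if "0 \<le> x" "x \<le> N" for x
    using that by auto
  have bound: "\<bar>r' x\<bar> \<le> max 1 B" if "0 \<le> x" for x
    using N[of x] B[OF that] by (cases "N \<le> x") auto
  have "(max 1 B)-lipschitz_on {0..} r"
  proof (rule bounded_derivative_imp_lipschitz)
    fix x :: real assume x: "x \<in> {0..}"
    then show "(r has_derivative (*) (r' x)) (at x within {0..})"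
      using r'[of x] by (simp add: has_field_derivative_def)
    show "onorm ((*) (r' x)) \<le> max 1 B"
      using bound[of x] x by (intro onorm_le) (simp add: abs_mult mult_right_mono)
  qed auto
  then show ?thesis by (intro that[of "max 1 B"]) auto
qed

text \<open>
  A non-decreasing function lies below its limit at infinity.
\<close>

lemma recycling_rate_bounded:
  assumes "recycling_rate b \<rho> r"
  obtains a where "\<And>x. 0 \<le> x \<Longrightarrow> r x \<le> a"
proof -
  have mono: "mono_on {0..} r" and "\<exists>a. (r \<longlongrightarrow> a) at_top"
    using assms unfolding recycling_rate_def by blast+
  then obtain a where a: "(r \<longlongrightarrow> a) at_top" by blast
  have "r x \<le> a" if "0 \<le> x" for x
  proof (rule tendsto_lowerbound[OF a])
    show "\<forall>\<^sub>F y in at_top. r x \<le> r y"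
      using eventually_ge_at_top[of x] by eventually_elim (use mono that in \<open>auto simp: mono_on_def\<close>)
  qed simp
  then show ?thesis by (rule that)
qed

theorem theorem1:
  fixes M :: "'a measure" and F :: "real \<Rightarrow> 'a measure" and W :: "real \<Rightarrow> 'a \<Rightarrow> real"
    and b c \<rho> :: real and r :: "real \<Rightarrow> real"
  assumes "shallow_lake M F W b c \<rho> r"
  shows "\<exists>V :: real \<Rightarrow> real.
           (\<forall>x\<ge>0. value_function M F b c \<rho> r x = ereal (V x)) \<and>
           constrained_viscosity_solution \<rho> (hamiltonian b c r) V \<and>
           (\<exists>D. (V has_real_derivative D) (at 0 within {0..}) \<and>
                D < 0 \<and> ln (- D) + \<rho> * V 0 + 1 = 0)"
proof -
  interpret shallow_lake M F W b c \<rho> r by (rule assms)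
  obtain L where L: "0 < L" "L-lipschitz_on {0..} r" using recycling_rate_lipschitz[OF recycling_rate] .
  obtain a where a: "\<And>x. 0 \<le> x \<Longrightarrow> r x \<le> a" using recycling_rate_bounded[OF recycling_rate] by blast
  have r: "mono_on {0..} r" "r 0 = 0" using recycling_rate by (auto simp: recycling_rate_def)
  interpret lake_on_probability_space M F W b c \<rho> r L a
    by unfold_locales (use pos_b pos_c pos_\<rho> L a r in \<open>auto simp: mono_on_def\<close>)
  show ?thesis
    using value_function_eq_V V_continuous V_subsolution V_supersolution V_derivative_at_0
    unfolding constrained_viscosity_solution_def by (intro exI[of _ V]) auto
qed

end
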